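(* Let $U\subset\mathbb R_\infty^n$ be an open subset and $T\in D^{p,p}(U)$ a positive Lagerberg current, and put $q=n-p$. Then the co-coefficients $T^{IJ}$ are real Radon measures on $U\setminus E^{I\cup J}$ that satisfy $T^{IJ}=T^{JI}$ for all $I,J\subset\{1,\dots,n\}$ with $|I|=|J|=q$. Moreover, all $T^{II}$ are positive Radon measures and the total variation measures $|T^{IJ}|$ satisfy the estimates $$\lambda_I\lambda_J|T^{IJ}|\le\tfrac12\left(\lambda_I^2T^{II}+\lambda_J^2T^{JJ}\right)$$ (on $U\setminus E^{I\cup J}$) for any pair of real numbers $\lambda_I,\lambda_J\ge0$.
   Context: **Space.** $N=\mathbb Z^n$, $\mathbb R_\infty=\mathbb R\cup\{\infty\}$, $\Sigma$ is the fan of faces of $\mathbb R_{\ge0}^n$: $\sigma_L=\{u\in\mathbb R_{\ge0}^n:u_i=0\ \forall i\notin L\}$, $L\subset\{1,\dots,n\}$. $N_\Sigma=\mathbb R_\infty^n$ (product topology) is stratified by the real vector spaces $N(\sigma_L)=\{u:u_i=\infty\iff i\in L\}$; for $L'\subset L$, $\pi_{\sigma_L,\sigma_{L'}}\colon N(\sigma_{L'})\to N(\sigma_L)$ forgets the coordinates in $L\setminus L'$. For $K\subset\{1,\dots,n\}$, $E^K=\{u\in\mathbb R_\infty^n:u_i=\infty\text{ for some }i\in K\}$. **Lagerberg forms.** For $W$ open in a real vector space with linear coordinates $u_i$, $A^{p,q}(W)=A^p(W)\otimes_{C^\infty(W)}A^q(W)$ (real smooth forms), elements $\sum f_{IJ}d'u_I\wedge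 d''u_J$; all $d'u_i,d''u_j$ anticommute; $J$ is the $C^\infty$-linear algebra involution exchanging $d'u_i$ and $d''u_i$. For $U\subset N_\Sigma$ open, $A^{p,q}(U)$ is the set of families $\omega=(\omega_\sigma)_\sigma$, $\omega_\sigma\in A^{p,q}(U\cap N(\sigma))$, such that each $x\in U\cap N(\sigma)$ has a neighborhood $V'$ in $U$ with $\omega_\tau=\pi_{\sigma,\tau}^*\omega_\sigma$ on $V'\cap N(\tau)\cap\pi_{\sigma,\tau}^{-1}(V'\cap N(\sigma))$ for all faces $\tau\prec\sigma$; $A_c^{p,q}(U)$ are those with compact support. $\omega\in A^{p,p}(U)$ is positive if pointwise in the convex cone spanned by $(-1)^{p(p-1)/2}\alpha\wedge J(\alpha)$, $\alpha$ of type $(p,0)$. **Currents.** For $K\subset U$ compact and a finite open covering $(V_i)_i$ of $K$ in $U$, $A_K^{p,q}(U,(V_i)_i)$ is the space of $\omega\in A_c^{p,q}(U)$ supported in $K$ with $\omega_\tau=\pi_{\sigma,\tau}^*\omega_\sigma$ on $V_i\cap N(\tau)\cap\pi_{\sigma,\tau}^{-1}(V_i\cap N(\sigma))$ for all $i$, $\tau\prec\sigma$ with $V_i\cap N(\sigma)\neq\emptyset$, with norms $\|\omega\|_m=\sum_{|\alpha|\le m}\sum_{I,J}\sup_K|\partial^\alpha f_{IJ}|$. $A_c^{p,q}(U)$ has the direct limit topology in locally convex topological vector spaces; $D^{p,q}(U)$ is the space of continuous linear functionals $A_c^{n-p,n-q}(U)\to\mathbb R$. $T\in D^{p,p}(U)$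 is positive if it is symmetric, i.e. $T(J\omega)=(-1)^{n-p}T(\omega)$ for all $\omega$, and $T(\alpha)\ge0$ for all positive $\alpha\in A_c^{n-p,n-p}(U)$. **Co-coefficients.** $T^{IJ}\in D^{n,n}(U\setminus E^{I\cup J})$ is $T^{IJ}(f)=T((-1)^{q(q-1)/2}f\,d'u_I\wedge d''u_J)$, $f\in A_c^{0,0}(U\setminus E^{I\cup J})$. A real Radon measure on a locally compact space $Y$ is a continuous linear functional on $C_c^0(Y,\mathbb R)$; $T^{IJ}$ being one means it is the restriction of such a (necessarily unique) functional. *)

theory Defs
  imports "HOL-Analysis.Analysis" "HOL-Library.Function_Algebras"
begin

text \<open>The pointwise real vector space structure on function spaces.\<close>

instantiation "fun" :: (type, real_vector) real_vector
begin

definition scaleR_fun :: "real \<Rightarrow> ('a \<Rightarrow> 'b) \<Rightarrow> 'a \<Rightarrow> 'b"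
  where "scaleR_fun c f = (\<lambda>x. c *\<^sub>R f x)"

instance
  by standard (auto simp: scaleR_fun_def fun_eq_iff scaleR_add_right scaleR_add_left)

end


section \<open>The space \<open>\<real>\<^sub>\<infinity>\<^sup>n\<close> and its strata\<close>

type_synonym point = "nat \<Rightarrow> ereal"

definition Rinf :: "nat \<Rightarrow> point set"
  where "Rinf n = ({1..n} \<rightarrow>\<^sub>E {-\<infinity><..})"

text \<open>The topology used on \<open>Rinf n\<close> is the one induced by the type \<open>point\<close>; it is the product topology:\<close>

lemma top_of_set_Rinf:
  "top_of_set (Rinf n) = product_topology (\<lambda>_. top_of_set {-\<infinity><..}) {1..n}"
proof -
  let ?X = "top_of_set (Rinf n)"
  let ?Y = "product_topology (\<lambda>_::nat. top_of_set {-\<infinity>::ereal<..}) {1..n}"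
  have ts: "topspace ?X = topspace ?Y"
    by (simp add: Rinf_def)
  have XY: "continuous_map ?X ?Y (\<lambda>x. x)"
    unfolding continuous_map_componentwise
  proof (intro conjI ballI)
    show "(\<lambda>x. x) ` topspace ?X \<subseteq> extensional {1..n}"
      by (auto simp: Rinf_def PiE_def)
    fix k assume "k \<in> {1..n}"
    then show "continuous_map ?X (top_of_set {-\<infinity><..}) (\<lambda>x. x k)"
      by (auto simp: Rinf_def PiE_def Pi_def
          intro!: continuous_on_subset[OF continuous_on_product_coordinates])
  qed
  have c: "continuous_map ?Y euclidean (\<lambda>x. x k)" for k
  proof (cases "k \<in> {1..n}")
    case True
    then have "continuous_map ?Y (top_of_set {-\<infinity><..}) (\<lambda>x. x k)"
      by (rule continuous_map_product_projection)
    then show ?thesis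
      by (rule continuous_map_into_fulltopology)
  next
    case False
    have "continuous_map ?Y euclidean (\<lambda>x. undefined)" by simp
    then show ?thesis
      by (rule continuous_map_eq) (use False in \<open>auto simp: PiE_def extensional_def\<close>)
  qed
  have "continuous_map ?Y euclidean (\<lambda>x. x)"
    unfolding euclidean_product_topology[symmetric] continuous_map_componentwise
    using c by auto
  then have YX: "continuous_map ?Y ?X (\<lambda>x. x)"
    using ts by (auto simp: continuous_map_in_subtopology)
  have "openin ?X S \<longleftrightarrow> openin ?Y S" for S
  proof
    assume S: "openin ?X S"
    have "openin ?Y {x \<in> topspace ?Y. x \<in> S}"
      using YX S unfolding continuous_map_def by blast
    moreover have "{x \<in> topspace ?Y. x \<in> S} = S"
      using openin_subset[OF S] ts by auto
    ultimately show "openin ?Y S" by simp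
  next
    assume S: "openin ?Y S"
    have "openin ?X {x \<in> topspace ?X. x \<in> S}"
      using XY S unfolding continuous_map_def by blast
    moreover have "{x \<in> topspace ?X. x \<in> S} = S"
      using openin_subset[OF S] ts by auto
    ultimately show "openin ?X S" by simp
  qed
  then show ?thesis
    by (simp add: topology_eq)
qed

definition infs :: "nat \<Rightarrow> point \<Rightarrow> nat set"
  where "infs n x = {i \<in> {1..n}. x i = \<infinity>}"

text \<open>\<open>stratum n L\<close> is \<open>N(\<sigma>\<^sub>L)\<close>, with linear coordinates \<open>u\<^sub>i\<close> for \<open>i \<in> {1..n} - L\<close>;
  \<open>to_stratum L\<close> restricts to \<open>\<pi>\<close> from \<open>N(\<sigma>\<^sub>L\<^sub>')\<close> to \<open>N(\<sigma>\<^sub>L)\<close> for every \<open>L' \<subseteq> L\<close>.\<close>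

definition stratum :: "nat \<Rightarrow> nat set \<Rightarrow> point set"
  where "stratum n L = {x \<in> Rinf n. infs n x = L}"

definition to_stratum :: "nat set \<Rightarrow> point \<Rightarrow> point"
  where "to_stratum L x = (\<lambda>i. if i \<in> L then \<infinity> else x i)"

definition Einf :: "nat \<Rightarrow> nat set \<Rightarrow> point set"
  where "Einf n K = {x \<in> Rinf n. \<exists>i\<in>K. x i = \<infinity>}"


section \<open>Smooth functions on strata\<close>

text \<open>Partial derivatives are taken along the stratum through the point: the direction \<open>u\<^sub>i\<close> is not
  available where \<open>x i = \<infinity>\<close>, and the value there is 0.\<close>

definition pd :: "nat \<Rightarrow> (point \<Rightarrow> real) \<Rightarrow> point \<Rightarrow> real"
  where "pd i f x = (if \<bar>x i\<bar> = \<infinity> then 0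
           else deriv (\<lambda>t. f (x(i := ereal t))) (real_of_ereal (x i)))"

definition smooth_on_stratum :: "nat \<Rightarrow> nat set \<Rightarrow> point set \<Rightarrow> (point \<Rightarrow> real) \<Rightarrow> bool"
  where "smooth_on_stratum n L W f \<longleftrightarrow>
    (\<forall>is. set is \<subseteq> {1..n} - L \<longrightarrow>
       continuous_on W (foldr pd is f) \<and>
       (\<forall>x\<in>W. \<forall>i\<in>{1..n} - L.
          (\<lambda>t. foldr pd is f (x(i := ereal t))) differentiable at (real_of_ereal (x i))))"

definition multi_indices :: "nat \<Rightarrow> nat \<Rightarrow> (nat \<Rightarrow> nat) set"
  where "multi_indices n m = {\<alpha>. (\<forall>i. i \<notin> {1..n} \<longrightarrow> \<alpha> i = 0) \<and> (\<Sum>i\<in>{1..n}. \<alpha> i) \<le> m}"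

definition multi_pd :: "nat \<Rightarrow> (nat \<Rightarrow> nat) \<Rightarrow> (point \<Rightarrow> real) \<Rightarrow> point \<Rightarrow> real"
  where "multi_pd n \<alpha> f = foldr (\<lambda>i. pd i ^^ \<alpha> i) [1..<Suc n] f"


section \<open>Lagerberg forms\<close>

text \<open>The value of a form at a point: \<open>\<alpha> I J\<close> is the coefficient of \<open>d'u\<^sub>I \<and> d''u\<^sub>J\<close>, where the
  factors of \<open>d'u\<^sub>I\<close> and \<open>d''u\<^sub>J\<close> are in increasing order of the indices.\<close>

type_synonym lval = "nat set \<Rightarrow> nat set \<Rightarrow> real"

type_synonym lform = "point \<Rightarrow> lval"

definition du :: "nat set \<Rightarrow> nat set \<Rightarrow> lval"
  where "du I J = (\<lambda>A B. if A = I \<and> B = J then 1 else 0)"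

definition lval_of_type :: "nat set \<Rightarrow> nat \<Rightarrow> nat \<Rightarrow> lval \<Rightarrow> bool"
  where "lval_of_type S p q \<alpha> \<longleftrightarrow>
    (\<forall>I J. \<alpha> I J \<noteq> 0 \<longrightarrow> I \<subseteq> S \<and> J \<subseteq> S \<and> card I = p \<and> card J = q)"

text \<open>For disjoint \<open>I\<close>, \<open>K\<close> one has \<open>d'u\<^sub>I \<and> d'u\<^sub>K = shuffle_sign I K d'u\<^sub>I\<^sub>\<union>\<^sub>K\<close>, and the product
  \<open>d'u\<^sub>I \<and> d''u\<^sub>J \<and> d'u\<^sub>K \<and> d''u\<^sub>M\<close> is brought to normal form by moving \<open>d'u\<^sub>K\<close> across \<open>d''u\<^sub>J\<close>.\<close>

definition shuffle_sign :: "nat set \<Rightarrow> nat set \<Rightarrow> real"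
  where "shuffle_sign I K = (-1) ^ card {(i, k). i \<in> I \<and> k \<in> K \<and> k < i}"

definition wedge :: "lval \<Rightarrow> lval \<Rightarrow> lval"
  where "wedge \<alpha> \<beta> = (\<lambda>A B. \<Sum>I\<in>Pow A. \<Sum>J\<in>Pow B.
     (-1) ^ (card J * card (A - I)) * shuffle_sign I (A - I) * shuffle_sign J (B - J)
       * \<alpha> I J * \<beta> (A - I) (B - J))"

text \<open>\<open>J(d'u\<^sub>J \<and> d''u\<^sub>I) = d''u\<^sub>J \<and> d'u\<^sub>I = (-1)\<^bsup>|I||J|\<^esup> d'u\<^sub>I \<and> d''u\<^sub>J\<close>\<close>

definition Jval :: "lval \<Rightarrow> lval"
  where "Jval \<alpha> = (\<lambda>I J. (-1) ^ (card I * card J) * \<alpha> J I)"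

definition Jform :: "lform \<Rightarrow> lform"
  where "Jform \<omega> = (\<lambda>x. Jval (\<omega> x))"

text \<open>A family \<open>(\<omega>\<^sub>\<sigma>)\<^sub>\<sigma>\<close> is encoded as the single map sending \<open>x \<in> U \<inter> N(\<sigma>)\<close> to the value of
  \<open>\<omega>\<^sub>\<sigma>\<close> at \<open>x\<close>, extended by 0 outside \<open>U\<close>. On \<open>N(\<sigma>\<^sub>L)\<close> only indices outside \<open>L\<close> occur, so
  that \<open>\<pi>\<^sup>*\<omega>\<^sub>\<sigma>\<close> has the value \<open>\<omega> (to_stratum L y)\<close> at \<open>y\<close>.\<close>

definition compat_on :: "nat \<Rightarrow> nat set \<Rightarrow> point set \<Rightarrow> lform \<Rightarrow> bool"
  where "compat_on n L V \<omega> \<longleftrightarrow>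
    (\<forall>L'. L' \<subseteq> L \<longrightarrow> (\<forall>y \<in> V \<inter> stratum n L'.
        to_stratum L y \<in> V \<inter> stratum n L \<longrightarrow> \<omega> y = \<omega> (to_stratum L y)))"

definition lag_forms :: "nat \<Rightarrow> nat \<Rightarrow> nat \<Rightarrow> point set \<Rightarrow> lform set"
  where "lag_forms n p q U = {\<omega>.
    (\<forall>x. x \<notin> U \<longrightarrow> \<omega> x = 0) \<and>
    (\<forall>L\<subseteq>{1..n}.
       (\<forall>x \<in> U \<inter> stratum n L. lval_of_type ({1..n} - L) p q (\<omega> x)) \<and>
       (\<forall>I J. smooth_on_stratum n L (U \<inter> stratum n L) (\<lambda>x. \<omega> x I J)) \<and>
       (\<forall>x \<in> U \<inter> stratum n L. \<exists>V. openin (top_of_set U) V \<and> x \<in> V \<and> compat_on n L V \<omega>))}"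

definition supp_in :: "'a::topological_space set \<Rightarrow> ('a \<Rightarrow> 'b::zero) \<Rightarrow> 'a set"
  where "supp_in U f = U \<inter> closure {x \<in> U. f x \<noteq> 0}"

definition lag_forms_c :: "nat \<Rightarrow> nat \<Rightarrow> nat \<Rightarrow> point set \<Rightarrow> lform set"
  where "lag_forms_c n p q U = {\<omega> \<in> lag_forms n p q U. compact (supp_in U \<omega>)}"

definition pos_lvals :: "nat set \<Rightarrow> nat \<Rightarrow> lval set"
  where "pos_lvals S p = convex_cone hull
    {(-1) ^ (p * (p - 1) div 2) *\<^sub>R wedge \<alpha> (Jval \<alpha>) | \<alpha>. lval_of_type S p 0 \<alpha>}"

definition pos_form :: "nat \<Rightarrow> nat \<Rightarrow> point set \<Rightarrow> lform \<Rightarrow> bool"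
  where "pos_form n p U \<omega> \<longleftrightarrow> (\<forall>x\<in>U. \<omega> x \<in> pos_lvals ({1..n} - infs n x) p)"


section \<open>Locally convex direct limits\<close>

text \<open>\<open>D\<close> is a set of steps \<open>(F, \<nu>)\<close>: a subspace \<open>F\<close> of \<open>E\<close> whose topology is given by the
  seminorms \<open>\<nu> 0, \<nu> 1, \<dots>\<close>; \<open>E\<close> is the union of the steps. In the direct limit topology in
  locally convex spaces, i.e. the finest locally convex topology for which all inclusions are
  continuous, the absolutely convex sets meeting every step in a neighbourhood of 0
  are a neighbourhood basis of 0.\<close>

definition lc_zero_nbhd ::
    "'v::real_vector set \<Rightarrow> ('v set \<times> (nat \<Rightarrow> 'v \<Rightarrow> real)) set \<Rightarrow> 'v set \<Rightarrow> bool"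
  where "lc_zero_nbhd E D C \<longleftrightarrow> C \<subseteq> E \<and> convex C \<and>
    (\<forall>v\<in>C. \<forall>c. \<bar>c\<bar> \<le> 1 \<longrightarrow> c *\<^sub>R v \<in> C) \<and>
    (\<forall>(F, \<nu>) \<in> D. \<exists>m. \<exists>e>0. {v \<in> F. \<forall>k\<le>m. \<nu> k v < e} \<subseteq> C)"

definition lc_limit_topology ::
    "'v::real_vector set \<Rightarrow> ('v set \<times> (nat \<Rightarrow> 'v \<Rightarrow> real)) set \<Rightarrow> 'v topology"
  where "lc_limit_topology E D =
    topology (\<lambda>W. W \<subseteq> E \<and> (\<forall>w\<in>W. \<exists>C. lc_zero_nbhd E D C \<and> (\<lambda>v. w + v) ` C \<subseteq> W))"

lemma lc_zero_nbhd_Int: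
  assumes "lc_zero_nbhd E D C" "lc_zero_nbhd E D C'"
  shows "lc_zero_nbhd E D (C \<inter> C')"
  unfolding lc_zero_nbhd_def
proof (intro conjI)
  show "C \<inter> C' \<subseteq> E" "convex (C \<inter> C')"
    using assms by (auto simp: lc_zero_nbhd_def convex_Int)
  show "\<forall>v\<in>C \<inter> C'. \<forall>c. \<bar>c\<bar> \<le> 1 \<longrightarrow> c *\<^sub>R v \<in> C \<inter> C'"
    using assms by (auto simp: lc_zero_nbhd_def)
  show "\<forall>(F, \<nu>) \<in> D. \<exists>m. \<exists>e>0. {v \<in> F. \<forall>k\<le>m. \<nu> k v < e} \<subseteq> C \<inter> C'"
  proof clarify
    fix F \<nu> assume FD: "(F, \<nu>) \<in> D"
    obtain m e where 1: "e > 0" "{v \<in> F. \<forall>k\<le>m. \<nu> k v < e} \<subseteq> C"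
      using assms(1) FD unfolding lc_zero_nbhd_def by blast
    obtain m' e' where 2: "e' > 0" "{v \<in> F. \<forall>k\<le>m'. \<nu> k v < e'} \<subseteq> C'"
      using assms(2) FD unfolding lc_zero_nbhd_def by blast
    have "{v \<in> F. \<forall>k\<le>max m m'. \<nu> k v < min e e'} \<subseteq> C \<inter> C'"
      using 1(2) 2(2) by fastforce
    moreover have "min e e' > 0" using 1(1) 2(1) by simp
    ultimately show "\<exists>m. \<exists>e>0. {v \<in> F. \<forall>k\<le>m. \<nu> k v < e} \<subseteq> C \<inter> C'" by blast
  qed
qed

lemma openin_lc_limit_topology:
  "openin (lc_limit_topology E D) W \<longleftrightarrow>
    W \<subseteq> E \<and> (\<forall>w\<in>W. \<exists>C. lc_zero_nbhd E D C \<and> (\<lambda>v. w + v) ` C \<subseteq> W)"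
proof -
  let ?P = "\<lambda>W. W \<subseteq> E \<and> (\<forall>w\<in>W. \<exists>C. lc_zero_nbhd E D C \<and> (\<lambda>v. w + v) ` C \<subseteq> W)"
  have "?P (S \<inter> T)" if "?P S" "?P T" for S T
  proof (intro conjI ballI)
    show "S \<inter> T \<subseteq> E" using that by blast
    fix w assume "w \<in> S \<inter> T"
    then obtain C C' where "lc_zero_nbhd E D C" "(\<lambda>v. w + v) ` C \<subseteq> S"
      "lc_zero_nbhd E D C'" "(\<lambda>v. w + v) ` C' \<subseteq> T"
      using \<open>?P S\<close> \<open>?P T\<close> by (meson IntD1 IntD2)
    then show "\<exists>C. lc_zero_nbhd E D C \<and> (\<lambda>v. w + v) ` C \<subseteq> S \<inter> T"
      using lc_zero_nbhd_Int by (intro exI[of _ "C \<inter> C'"]) blast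
  qed
  moreover have "?P (\<Union>\<K>)" if "\<forall>S\<in>\<K>. ?P S" for \<K>
    using that by (meson Sup_least Sup_upper UnionE order_trans)
  ultimately have "istopology ?P"
    unfolding istopology_def by blast
  then show ?thesis
    unfolding lc_limit_topology_def by simp
qed

definition cont_functionals ::
    "'v::real_vector set \<Rightarrow> ('v set \<times> (nat \<Rightarrow> 'v \<Rightarrow> real)) set \<Rightarrow> ('v \<Rightarrow> real) set"
  where "cont_functionals E D = {T.
    (\<forall>v\<in>E. \<forall>w\<in>E. T (v + w) = T v + T w) \<and> (\<forall>c. \<forall>v\<in>E. T (c *\<^sub>R v) = c * T v) \<and>
    continuous_map (lc_limit_topology E D) euclideanreal T}"


section \<open>Lagerberg currents\<close>

definition lag_step :: "nat \<Rightarrow> nat \<Rightarrow> nat \<Rightarrow> point set \<Rightarrow> point set \<Rightarrow> point set set \<Rightarrow> lform set"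
  where "lag_step n p q U K \<V> = {\<omega> \<in> lag_forms_c n p q U. supp_in U \<omega> \<subseteq> K \<and>
    (\<forall>V\<in>\<V>. \<forall>L\<subseteq>{1..n}. V \<inter> stratum n L \<noteq> {} \<longrightarrow> compat_on n L V \<omega>)}"

text \<open>The inserted 0 only matters for \<open>K = {}\<close>.\<close>

definition lag_norm :: "nat \<Rightarrow> nat \<Rightarrow> nat \<Rightarrow> point set \<Rightarrow> nat \<Rightarrow> lform \<Rightarrow> real"
  where "lag_norm n p q K m \<omega> =
    (\<Sum>\<alpha>\<in>multi_indices n m. \<Sum>I | I \<subseteq> {1..n} \<and> card I = p. \<Sum>J | J \<subseteq> {1..n} \<and> card J = q.
       Sup (insert 0 ((\<lambda>x. \<bar>multi_pd n \<alpha> (\<lambda>y. \<omega> y I J) x\<bar>) ` K)))"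

definition lag_steps :: "nat \<Rightarrow> nat \<Rightarrow> nat \<Rightarrow> point set \<Rightarrow> (lform set \<times> (nat \<Rightarrow> lform \<Rightarrow> real)) set"
  where "lag_steps n p q U = {(lag_step n p q U K \<V>, lag_norm n p q K) | K \<V>.
    compact K \<and> K \<subseteq> U \<and> finite \<V> \<and> (\<forall>V\<in>\<V>. openin (top_of_set U) V) \<and> K \<subseteq> \<Union>\<V>}"

definition currents :: "nat \<Rightarrow> nat \<Rightarrow> nat \<Rightarrow> point set \<Rightarrow> (lform \<Rightarrow> real) set"
  where "currents n p q U =
    cont_functionals (lag_forms_c n (n - p) (n - q) U) (lag_steps n (n - p) (n - q) U)"

definition positive_current :: "nat \<Rightarrow> nat \<Rightarrow> point set \<Rightarrow> (lform \<Rightarrow> real) \<Rightarrow> bool"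
  where "positive_current n p U T \<longleftrightarrow>
    (\<forall>\<omega> \<in> lag_forms_c n (n - p) (n - p) U. T (Jform \<omega>) = (-1) ^ (n - p) * T \<omega>) \<and>
    (\<forall>\<omega> \<in> lag_forms_c n (n - p) (n - p) U. pos_form n (n - p) U \<omega> \<longrightarrow> 0 \<le> T \<omega>)"


section \<open>Co-coefficients and Radon measures\<close>

text \<open>\<open>A\<^sub>c\<^sup>0\<^sup>,\<^sup>0(Y)\<close>, with \<open>(0,0)\<close>-forms regarded as functions.\<close>

definition test_functions :: "nat \<Rightarrow> point set \<Rightarrow> (point \<Rightarrow> real) set"
  where "test_functions n Y = {f. (\<lambda>x. f x *\<^sub>R du {} {}) \<in> lag_forms_c n 0 0 Y}"

text \<open>Functions on \<open>Y\<close> vanish outside \<open>Y\<close>, so extension by 0 to a larger open set is implicit.\<close>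

definition cocoeff :: "nat \<Rightarrow> (lform \<Rightarrow> real) \<Rightarrow> nat set \<Rightarrow> nat set \<Rightarrow> (point \<Rightarrow> real) \<Rightarrow> real"
  where "cocoeff q T I J f = T (\<lambda>x. ((-1) ^ (q * (q - 1) div 2) * f x) *\<^sub>R du I J)"

definition Cc :: "'a::topological_space set \<Rightarrow> ('a \<Rightarrow> real) set"
  where "Cc Y = {f. continuous_on Y f \<and> (\<forall>x. x \<notin> Y \<longrightarrow> f x = 0) \<and> compact (supp_in Y f)}"

definition Cc_steps :: "'a::topological_space set \<Rightarrow> (('a \<Rightarrow> real) set \<times> (nat \<Rightarrow> ('a \<Rightarrow> real) \<Rightarrow> real)) set"
  where "Cc_steps Y = {({f \<in> Cc Y. supp_in Y f \<subseteq> K}, \<lambda>_ f. Sup (insert 0 ((\<lambda>x. \<bar>f x\<bar>) ` K))) | K.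
    compact K \<and> K \<subseteq> Y}"

definition radon_measures :: "'a::topological_space set \<Rightarrow> (('a \<Rightarrow> real) \<Rightarrow> real) set"
  where "radon_measures Y = cont_functionals (Cc Y) (Cc_steps Y)"

definition measure_le ::
    "'a::topological_space set \<Rightarrow> (('a \<Rightarrow> real) \<Rightarrow> real) \<Rightarrow> (('a \<Rightarrow> real) \<Rightarrow> real) \<Rightarrow> bool"
  where "measure_le Y \<mu> \<nu> \<longleftrightarrow> (\<forall>f \<in> Cc Y. (\<forall>x. 0 \<le> f x) \<longrightarrow> \<mu> f \<le> \<nu> f)"

text \<open>\<open>|\<mu>|(f) = sup {\<mu>(g) | |g| \<le> f}\<close> for \<open>f \<ge> 0\<close>, extended by \<open>|\<mu>|(f) = |\<mu>|(f\<^sup>+) - |\<mu>|(f\<^sup>-)\<close>.\<close>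

definition total_variation ::
    "'a::topological_space set \<Rightarrow> (('a \<Rightarrow> real) \<Rightarrow> real) \<Rightarrow> ('a \<Rightarrow> real) \<Rightarrow> real"
  where "total_variation Y \<mu> f =
    (SUP g \<in> {g \<in> Cc Y. \<forall>x. \<bar>g x\<bar> \<le> max (f x) 0}. \<mu> g) -
    (SUP g \<in> {g \<in> Cc Y. \<forall>x. \<bar>g x\<bar> \<le> max (- f x) 0}. \<mu> g)"

end

theory Submission
  imports Defs
begin

text \<open>
  For a constant form \<open>\<alpha> = a d'u\<^sub>I + b d'u\<^sub>J\<close> and a test function \<open>f \<ge> 0\<close> on
  \<open>U - E\<^bsup>I\<union>J\<^esup>\<close>, the form \<open>(-1)\<^bsup>q(q-1)/2\<^esup> f \<alpha> \<and> J(\<alpha>)\<close> is positive. Applying \<open>T\<close> to it and using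
  that \<open>T\<close> is symmetric gives
  \<open>a\<^sup>2 T\<^bsup>II\<^esup>(f) + b\<^sup>2 T\<^bsup>JJ\<^esup>(f) + 2ab T\<^bsup>IJ\<^esup>(f) \<ge> 0\<close> for all real \<open>a\<close> and \<open>b\<close>
  (\<open>cocoeff_quadratic_form\<close>). Everything else is a consequence of these inequalities.

  With \<open>a = 1\<close>, \<open>b = \<plusminus>1\<close> they say that \<open>T\<^bsup>IJ\<^esup>\<close> is dominated by \<open>(T\<^bsup>II\<^esup> + T\<^bsup>JJ\<^esup>)/2\<close>. A linear
  functional on test functions that is dominated by another one extends to all of \<open>C\<^sub>c\<close>, provided that
  every \<open>f\<close> in \<open>C\<^sub>c\<close> is a limit of test functions \<open>g\<^sub>k\<close> in the strong sense
  \<open>\<bar>f - g\<^sub>k\<bar> \<le> \<kappa>/(k+1)\<close> with one test function \<open>\<kappa>\<close> for all \<open>k\<close>: then the values on the \<open>g\<^sub>k\<close>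
  form a Cauchy sequence (\<open>extension_limit\<close>). The extension is bounded on functions with support in a
  fixed compact set, hence a Radon measure (\<open>extension_radon_measure\<close>), and the quadratic inequalities
  pass to the limit. Evaluating them at \<open>f + h\<close> and \<open>f - h\<close> with \<open>\<bar>h\<bar> \<le> f\<close> and opposite signs of \<open>b\<close>
  bounds \<open>2ab T\<^bsup>IJ\<^esup>(h)\<close> by \<open>a\<^sup>2 T\<^bsup>II\<^esup>(f) + b\<^sup>2 T\<^bsup>JJ\<^esup>(f)\<close>, and the supremum over \<open>h\<close> is the estimate of the
  total variation.

  The analytic part is the approximation (\<open>Cc_order_approx\<close>). It uses the algebra of functions on
  \<open>\<real>\<^sub>\<infinity>\<^sup>n\<close> generated by the functions \<open>t\<^bsup>-m\<^esup> exp (-1/t)\<close> of \<open>t = b - u\<^sub>i\<close>, extended by \<open>0\<close> to \<open>t \<le> 0\<close>,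
  and closed under composition with the same functions. Its members are smooth on all strata and
  locally pulled back from the stratum through the given point, because the generators vanish near \<open>u\<^sub>i = \<infinity>\<close>. It contains enough bump functions to
  separate points, so the Stone-Weierstrass theorem applies.
\<close>

section \<open>Extending dominated functionals along order approximations\<close>

definition linear_functional_on :: "('a::real_vector) set \<Rightarrow> ('a \<Rightarrow> real) \<Rightarrow> bool"
  where "linear_functional_on E l \<longleftrightarrow>
    (\<forall>f\<in>E. \<forall>g\<in>E. l (f + g) = l f + l g) \<and> (\<forall>c. \<forall>f\<in>E. l (c *\<^sub>R f) = c * l f)"

lemma linear_functional_on_add:
  "linear_functional_on E l \<Longrightarrow> f \<in> E \<Longrightarrow> g \<in> E \<Longrightarrow> l (f + g) = l f + l g"
  unfolding linear_functional_on_def by blast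

lemma linear_functional_on_scale:
  "linear_functional_on E l \<Longrightarrow> f \<in> E \<Longrightarrow> l (c *\<^sub>R f) = c * l f"
  unfolding linear_functional_on_def by blast

lemma linear_functional_on_diff:
  assumes "subspace E" "linear_functional_on E l" "f \<in> E" "g \<in> E"
  shows "l (f - g) = l f - l g"
proof -
  have "l (f + (-1) *\<^sub>R g) = l f + l ((-1) *\<^sub>R g)"
    by (rule linear_functional_on_add[OF assms(2,3) subspace_scale[OF assms(1,4)]])
  also have "l ((-1) *\<^sub>R g) = - l g"
    by (subst linear_functional_on_scale[OF assms(2,4)]) simp
  finally show ?thesis by simp
qed

lemma linear_functional_on_zero:
  assumes "subspace E" "linear_functional_on E l"
  shows "l 0 = 0"
  using linear_functional_on_diff[OF assms, of 0 0] subspace_0[OF assms(1)] by simp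

lemma linear_functional_on_combination:
  assumes "linear_functional_on E l" "linear_functional_on E m"
  shows "linear_functional_on E (\<lambda>f. a * l f + b * m f)"
  using assms unfolding linear_functional_on_def by (auto simp: algebra_simps)

definition positive_on :: "('a \<Rightarrow> real) set \<Rightarrow> (('a \<Rightarrow> real) \<Rightarrow> real) \<Rightarrow> bool"
  where "positive_on E N \<longleftrightarrow> (\<forall>f\<in>E. (\<forall>x. 0 \<le> f x) \<longrightarrow> 0 \<le> N f)"

definition dominated_on ::
    "('a \<Rightarrow> real) set \<Rightarrow> (('a \<Rightarrow> real) \<Rightarrow> real) \<Rightarrow> (('a \<Rightarrow> real) \<Rightarrow> real) \<Rightarrow> bool"
  where "dominated_on E l N \<longleftrightarrow> (\<forall>h\<in>E. \<forall>k\<in>E. (\<forall>x. \<bar>h x\<bar> \<le> k x) \<longrightarrow> \<bar>l h\<bar> \<le> N k)"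

lemma positive_onD: "positive_on E N \<Longrightarrow> f \<in> E \<Longrightarrow> (\<And>x. 0 \<le> f x) \<Longrightarrow> 0 \<le> N f"
  unfolding positive_on_def by blast

lemma dominated_onD:
  "dominated_on E l N \<Longrightarrow> h \<in> E \<Longrightarrow> k \<in> E \<Longrightarrow> (\<And>x. \<bar>h x\<bar> \<le> k x) \<Longrightarrow> \<bar>l h\<bar> \<le> N k"
  unfolding dominated_on_def by blast

text \<open>The two positive functions \<open>k + h\<close> and \<open>k - h\<close> do the work of the positive and negative
  part of \<open>h\<close>, which in general are not smooth.\<close>

lemma dominated_onI:
  assumes E: "subspace E" and l: "linear_functional_on E l" and N: "linear_functional_on E N"
    and plus: "positive_on E (\<lambda>f. N f + l f)" and minus: "positive_on E (\<lambda>f. N f - l f)"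
  shows "dominated_on E l N"
  unfolding dominated_on_def
proof (intro ballI impI)
  fix h k assume hk: "h \<in> E" "k \<in> E" and le: "\<forall>x. \<bar>h x\<bar> \<le> k x"
  have sums: "k + h \<in> E" "k - h \<in> E"
    using hk E by (auto simp: subspace_add subspace_diff)
  have nonneg: "0 \<le> (k + h) x" "0 \<le> (k - h) x" for x
    using le[rule_format, of x] by (auto simp: abs_le_iff)
  have add: "m (k + h) = m k + m h" "m (k - h) = m k - m h"
    if "linear_functional_on E m" for m
    using linear_functional_on_add[OF that hk(2,1)] linear_functional_on_diff[OF E that hk(2,1)] by auto
  have "0 \<le> N (k + h) + l (k + h)" "0 \<le> N (k - h) + l (k - h)"
    "0 \<le> N (k + h) - l (k + h)" "0 \<le> N (k - h) - l (k - h)"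
    using positive_onD[OF plus sums(1)] positive_onD[OF plus sums(2)]
      positive_onD[OF minus sums(1)] positive_onD[OF minus sums(2)] nonneg by auto
  then show "\<bar>l h\<bar> \<le> N k"
    by (simp add: add[OF l] add[OF N] abs_le_iff)
qed

text \<open>Uniform convergence with a common majorant \<open>\<kappa>\<close> from \<open>E\<close> itself replaces uniform convergence
  with supports in a common compact set; it makes sense for any space of functions and is respected by
  every dominated functional.\<close>

definition order_approx :: "('a \<Rightarrow> real) set \<Rightarrow> ('a \<Rightarrow> real) \<Rightarrow> (nat \<Rightarrow> 'a \<Rightarrow> real) \<Rightarrow> bool"
  where "order_approx E f g \<longleftrightarrow> (\<exists>\<kappa>\<in>E. (\<forall>x. 0 \<le> \<kappa> x) \<and>
    (\<forall>k. g k \<in> E \<and> (\<forall>x. \<bar>f x - g k x\<bar> \<le> inverse (real (Suc k)) * \<kappa> x)))"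

text \<open>The approximating sequence is chosen from \<open>f\<close> and \<open>E\<close> alone; \<open>extension_limit\<close> shows that any
  other one gives the same value.\<close>

definition extension :: "('a \<Rightarrow> real) set \<Rightarrow> (('a \<Rightarrow> real) \<Rightarrow> real) \<Rightarrow> ('a \<Rightarrow> real) \<Rightarrow> real"
  where "extension E l f = lim (\<lambda>k. l ((SOME g. order_approx E f g) k))"

lemma order_approxI:
  assumes "\<kappa> \<in> E" "\<And>x. 0 \<le> \<kappa> x" "\<And>k. g k \<in> E"
    and "\<And>k x. \<bar>f x - g k x\<bar> \<le> inverse (real (Suc k)) * \<kappa> x"
  shows "order_approx E f g"
  unfolding order_approx_def using assms by (intro bexI[of _ \<kappa>] conjI allI)

lemma order_approxE:
  assumes "order_approx E f g"
  obtains \<kappa> where "\<kappa> \<in> E" "\<And>x. 0 \<le> \<kappa> x" "\<And>k. g k \<in> E"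
    "\<And>k x. \<bar>f x - g k x\<bar> \<le> inverse (real (Suc k)) * \<kappa> x"
  using assms unfolding order_approx_def by blast

lemma order_approx_mem: "order_approx E f g \<Longrightarrow> g k \<in> E"
  unfolding order_approx_def by blast

lemma order_approx_mono: "order_approx E f g \<Longrightarrow> E \<subseteq> F \<Longrightarrow> order_approx F f g"
  unfolding order_approx_def by blast

lemma order_approx_self:
  assumes "subspace E" "f \<in> E"
  shows "order_approx E f (\<lambda>_. f)"
  using assms subspace_0[OF assms(1)] by (intro order_approxI[of 0]) auto

lemma order_approx_add:
  assumes E: "subspace E" and f: "order_approx E f g" and h: "order_approx E h k"
  shows "order_approx E (f + h) (\<lambda>j. g j + k j)"
proof -
  obtain \<kappa> \<psi> where \<kappa>: "\<kappa> \<in> E" "\<And>x. 0 \<le> \<kappa> x"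
      "\<And>j. g j \<in> E" "\<And>j x. \<bar>f x - g j x\<bar> \<le> inverse (real (Suc j)) * \<kappa> x"
    and \<psi>: "\<psi> \<in> E" "\<And>x. 0 \<le> \<psi> x"
      "\<And>j. k j \<in> E" "\<And>j x. \<bar>h x - k j x\<bar> \<le> inverse (real (Suc j)) * \<psi> x"
    using order_approxE[OF f] order_approxE[OF h] by metis
  have "\<bar>(f + h) x - (g j + k j) x\<bar> \<le> inverse (real (Suc j)) * (\<kappa> + \<psi>) x" for j x
    using \<kappa>(4)[of x j] \<psi>(4)[of x j] by (simp add: distrib_left)
  moreover have "0 \<le> (\<kappa> + \<psi>) x" for x
    using \<kappa>(2)[of x] \<psi>(2)[of x] by simp
  ultimately show ?thesis
    by (intro order_approxI[of "\<kappa> + \<psi>"] subspace_add[OF E] \<kappa>(1,3) \<psi>(1,3))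
qed

lemma order_approx_scale:
  assumes E: "subspace E" and f: "order_approx E f g"
  shows "order_approx E (c *\<^sub>R f) (\<lambda>j. c *\<^sub>R g j)"
proof -
  obtain \<kappa> where \<kappa>: "\<kappa> \<in> E" "\<And>x. 0 \<le> \<kappa> x"
      "\<And>j. g j \<in> E" "\<And>j x. \<bar>f x - g j x\<bar> \<le> inverse (real (Suc j)) * \<kappa> x"
    by (rule order_approxE[OF f]) (rule that)
  have "\<bar>(c *\<^sub>R f) x - (c *\<^sub>R g j) x\<bar> \<le> inverse (real (Suc j)) * (\<bar>c\<bar> *\<^sub>R \<kappa>) x" for j x
  proof -
    have "\<bar>(c *\<^sub>R f) x - (c *\<^sub>R g j) x\<bar> = \<bar>c\<bar> * \<bar>f x - g j x\<bar>"
      by (simp add: scaleR_fun_def abs_mult flip: right_diff_distrib)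
    also have "\<dots> \<le> \<bar>c\<bar> * (inverse (real (Suc j)) * \<kappa> x)"
      by (intro mult_left_mono \<kappa>(4)) auto
    finally show ?thesis by (simp add: scaleR_fun_def algebra_simps)
  qed
  moreover have "0 \<le> (\<bar>c\<bar> *\<^sub>R \<kappa>) x" for x
    using \<kappa>(2)[of x] by (simp add: scaleR_fun_def)
  moreover have "\<bar>c\<bar> *\<^sub>R \<kappa> \<in> E" "c *\<^sub>R g j \<in> E" for j
    using \<kappa>(1,3) E by (auto simp: subspace_scale)
  ultimately show ?thesis
    by (intro order_approxI[of "\<bar>c\<bar> *\<^sub>R \<kappa>"])
qed

text \<open>Both sequences are compared with \<open>f\<close>, so \<open>g\<^sub>j - h\<^sub>k\<close> is at most a small multiple of the sum of the
  two majorants. The case \<open>g = h\<close> is the Cauchy property, the case \<open>j = k\<close> independence of the sequence.\<close>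

lemma order_approx_bound:
  assumes E: "subspace E" and l: "linear_functional_on E l" and N: "linear_functional_on E N"
    and dom: "dominated_on E l N"
    and f: "order_approx E f g" and h: "order_approx E f h"
  obtains B where "\<And>j k. \<bar>l (g j) - l (h k)\<bar> \<le> (inverse (real (Suc j)) + inverse (real (Suc k))) * B"
proof -
  obtain \<kappa> \<psi> where \<kappa>: "\<kappa> \<in> E" "\<And>x. 0 \<le> \<kappa> x"
      "\<And>j. g j \<in> E" "\<And>j x. \<bar>f x - g j x\<bar> \<le> inverse (real (Suc j)) * \<kappa> x"
    and \<psi>: "\<psi> \<in> E" "\<And>x. 0 \<le> \<psi> x"
      "\<And>j. h j \<in> E" "\<And>j x. \<bar>f x - h j x\<bar> \<le> inverse (real (Suc j)) * \<psi> x"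
    using order_approxE[OF f] order_approxE[OF h] by metis
  have "\<bar>l (g j) - l (h k)\<bar> \<le> (inverse (real (Suc j)) + inverse (real (Suc k))) * N (\<kappa> + \<psi>)" for j k
  proof -
    let ?c = "inverse (real (Suc j)) + inverse (real (Suc k))"
    have "\<bar>(g j - h k) x\<bar> \<le> (?c *\<^sub>R (\<kappa> + \<psi>)) x" for x
    proof -
      have "\<bar>(g j - h k) x\<bar> \<le> \<bar>f x - g j x\<bar> + \<bar>f x - h k x\<bar>" by simp
      also have "\<dots> \<le> inverse (real (Suc j)) * \<kappa> x + inverse (real (Suc k)) * \<psi> x"
        by (intro add_mono \<kappa> \<psi>)
      also have "\<dots> \<le> ?c * \<kappa> x + ?c * \<psi> x"
        using \<kappa>(2)[of x] \<psi>(2)[of x] by (intro add_mono mult_right_mono) auto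
      finally show ?thesis by (simp add: scaleR_fun_def distrib_left)
    qed
    moreover have "g j - h k \<in> E" "?c *\<^sub>R (\<kappa> + \<psi>) \<in> E" "\<kappa> + \<psi> \<in> E"
      using \<kappa> \<psi> E by (auto simp: subspace_add subspace_diff subspace_scale)
    ultimately have "\<bar>l (g j - h k)\<bar> \<le> N (?c *\<^sub>R (\<kappa> + \<psi>))"
      by (intro dominated_onD[OF dom])
    also have "\<dots> = ?c * N (\<kappa> + \<psi>)"
      by (rule linear_functional_on_scale[OF N \<open>\<kappa> + \<psi> \<in> E\<close>])
    finally show ?thesis
      using linear_functional_on_diff[OF E l \<kappa>(3) \<psi>(3)] by simp
  qed
  then show thesis by (rule that)
qed

lemma extension_limit:
  assumes E: "subspace E" and l: "linear_functional_on E l" and N: "linear_functional_on E N"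
    and dom: "dominated_on E l N" and f: "order_approx E f g"
  shows "(\<lambda>k. l (g k)) \<longlonglongrightarrow> extension E l f"
proof -
  define h where "h = (SOME g. order_approx E f g)"
  have h: "order_approx E f h"
    unfolding h_def by (rule someI[of "order_approx E f", OF f])
  obtain B where B: "\<And>j k. \<bar>l (h j) - l (h k)\<bar> \<le> (inverse (real (Suc j)) + inverse (real (Suc k))) * B"
    by (rule order_approx_bound[OF E l N dom h h]) (rule that)
  have inv0: "(\<lambda>k. inverse (real (Suc k))) \<longlonglongrightarrow> 0"
    by (rule LIMSEQ_inverse_real_of_nat)
  have "Cauchy (\<lambda>k. l (h k))"
  proof (rule metric_CauchyI)
    fix e :: real assume e: "0 < e"
    have "(\<lambda>k. 2 * inverse (real (Suc k)) * \<bar>B\<bar>) \<longlonglongrightarrow> 2 * 0 * \<bar>B\<bar>"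
      by (intro tendsto_intros inv0)
    then have "\<forall>\<^sub>F k in sequentially. 2 * inverse (real (Suc k)) * \<bar>B\<bar> < e"
      using e order_tendstoD(2) by fastforce
    then obtain M where M: "2 * inverse (real (Suc M)) * \<bar>B\<bar> < e"
      by (auto simp: eventually_sequentially)
    have "dist (l (h i)) (l (h j)) < e" if "i \<ge> M" "j \<ge> M" for i j
    proof -
      have "inverse (real (Suc i)) \<le> inverse (real (Suc M))" "inverse (real (Suc j)) \<le> inverse (real (Suc M))"
        using that by (auto intro!: le_imp_inverse_le)
      then have "inverse (real (Suc i)) + inverse (real (Suc j)) \<le> 2 * inverse (real (Suc M))"
        by linarith
      then have "(inverse (real (Suc i)) + inverse (real (Suc j))) * \<bar>B\<bar> \<le> 2 * inverse (real (Suc M)) * \<bar>B\<bar>"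
        by (rule mult_right_mono) simp
      moreover have "(inverse (real (Suc i)) + inverse (real (Suc j))) * B
          \<le> (inverse (real (Suc i)) + inverse (real (Suc j))) * \<bar>B\<bar>"
        by (intro mult_left_mono) (simp_all add: add_nonneg_nonneg)
      ultimately show ?thesis
        using B[of i j] M unfolding dist_real_def by linarith
    qed
    then show "\<exists>M. \<forall>m\<ge>M. \<forall>n\<ge>M. dist (l (h m)) (l (h n)) < e" by blast
  qed
  then have lim: "(\<lambda>k. l (h k)) \<longlonglongrightarrow> extension E l f"
    unfolding extension_def h_def[symmetric]
    by (simp add: Cauchy_convergent_iff convergent_LIMSEQ_iff)
  obtain B' where B': "\<And>j k. \<bar>l (g j) - l (h k)\<bar> \<le> (inverse (real (Suc j)) + inverse (real (Suc k))) * B'"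
    by (rule order_approx_bound[OF E l N dom f h]) (rule that)
  have "(\<lambda>k. (inverse (real (Suc k)) + inverse (real (Suc k))) * B') \<longlonglongrightarrow> (0 + 0) * B'"
    by (intro tendsto_intros inv0)
  then have B'_lim: "(\<lambda>k. (inverse (real (Suc k)) + inverse (real (Suc k))) * B') \<longlonglongrightarrow> 0"
    by (simp only: add_0_right mult_zero_left)
  have "\<forall>\<^sub>F k in sequentially. norm (l (g k) - l (h k))
      \<le> (inverse (real (Suc k)) + inverse (real (Suc k))) * B'"
    unfolding real_norm_def by (intro always_eventually allI B')
  then have "(\<lambda>k. l (g k) - l (h k)) \<longlonglongrightarrow> 0"
    by (rule Lim_null_comparison[OF _ B'_lim])
  from tendsto_add[OF this lim] show ?thesis by simp
qed

text \<open>The functions \<open>g\<^sub>k\<close> need not be nonnegative, but \<open>g\<^sub>k + \<kappa>/(k+1)\<close> is, and the correction disappears in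
  the limit. The value \<open>r\<close> is left free so that the lemma applies to combinations of functionals whose
  extensions are taken on different spaces.\<close>

lemma extension_nonneg:
  assumes E: "subspace E" and P: "linear_functional_on E P" and pos: "positive_on E P"
    and f: "order_approx E f g" and f0: "\<And>x. 0 \<le> f x"
    and lim: "(\<lambda>k. P (g k)) \<longlonglongrightarrow> r"
  shows "0 \<le> r"
proof -
  obtain \<kappa> where \<kappa>: "\<kappa> \<in> E" "\<And>x. 0 \<le> \<kappa> x"
      "\<And>j. g j \<in> E" "\<And>j x. \<bar>f x - g j x\<bar> \<le> inverse (real (Suc j)) * \<kappa> x"
    by (rule order_approxE[OF f]) (rule that)
  have "0 \<le> P (g k) + inverse (real (Suc k)) * P \<kappa>" for k
  proof -
    have "0 \<le> (g k + inverse (real (Suc k)) *\<^sub>R \<kappa>) x" for x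
      using \<kappa>(4)[of x k] f0[of x] by (simp add: scaleR_fun_def)
    moreover have "inverse (real (Suc k)) *\<^sub>R \<kappa> \<in> E"
      by (rule subspace_scale[OF E \<kappa>(1)])
    ultimately have "0 \<le> P (g k + inverse (real (Suc k)) *\<^sub>R \<kappa>)"
      by (intro positive_onD[OF pos] subspace_add[OF E \<kappa>(3)])
    also have "\<dots> = P (g k) + inverse (real (Suc k)) * P \<kappa>"
      using linear_functional_on_add[OF P \<kappa>(3) \<open>inverse (real (Suc k)) *\<^sub>R \<kappa> \<in> E\<close>]
      by (simp only: linear_functional_on_scale[OF P \<kappa>(1)])
    finally show ?thesis .
  qed
  moreover have "(\<lambda>k. P (g k) + inverse (real (Suc k)) * P \<kappa>) \<longlonglongrightarrow> r + 0 * P \<kappa>"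
    by (intro tendsto_intros lim LIMSEQ_inverse_real_of_nat)
  ultimately show ?thesis
    using LIMSEQ_le_const[of _ "r + 0 * P \<kappa>" 0] by auto
qed

lemma extension_abs_le:
  assumes E: "subspace E" and l: "linear_functional_on E l" and N: "linear_functional_on E N"
    and dom: "dominated_on E l N"
    and f: "order_approx E f g" and \<kappa>: "\<kappa> \<in> E" and le: "\<And>x. \<bar>f x\<bar> \<le> \<kappa> x"
  shows "\<bar>extension E l f\<bar> \<le> N \<kappa>"
proof -
  obtain \<psi> where \<psi>: "\<psi> \<in> E" "\<And>x. 0 \<le> \<psi> x"
      "\<And>j. g j \<in> E" "\<And>j x. \<bar>f x - g j x\<bar> \<le> inverse (real (Suc j)) * \<psi> x"
    by (rule order_approxE[OF f]) (rule that)
  have "\<bar>l (g k)\<bar> \<le> N \<kappa> + inverse (real (Suc k)) * N \<psi>" for k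
  proof -
    have in_E: "inverse (real (Suc k)) *\<^sub>R \<psi> \<in> E"
      by (rule subspace_scale[OF E \<psi>(1)])
    have "\<bar>g k x\<bar> \<le> (\<kappa> + inverse (real (Suc k)) *\<^sub>R \<psi>) x" for x
      using \<psi>(4)[of x k] le[of x] by (simp add: scaleR_fun_def)
    then have "\<bar>l (g k)\<bar> \<le> N (\<kappa> + inverse (real (Suc k)) *\<^sub>R \<psi>)"
      by (intro dominated_onD[OF dom \<psi>(3) subspace_add[OF E \<kappa> in_E]])
    also have "\<dots> = N \<kappa> + inverse (real (Suc k)) * N \<psi>"
      using linear_functional_on_add[OF N \<kappa> in_E]
      by (simp only: linear_functional_on_scale[OF N \<psi>(1)])
    finally show ?thesis .
  qed
  moreover have "(\<lambda>k. \<bar>l (g k)\<bar>) \<longlonglongrightarrow> \<bar>extension E l f\<bar>"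
    by (intro tendsto_intros extension_limit[OF E l N dom f])
  moreover have "(\<lambda>k. N \<kappa> + inverse (real (Suc k)) * N \<psi>) \<longlonglongrightarrow> N \<kappa> + 0 * N \<psi>"
    by (intro tendsto_intros LIMSEQ_inverse_real_of_nat)
  ultimately show ?thesis
    using LIMSEQ_le[of "\<lambda>k. \<bar>l (g k)\<bar>" _ _ "N \<kappa> + 0 * N \<psi>"] by auto
qed

lemma extension_eq:
  assumes "subspace E" "linear_functional_on E l" "linear_functional_on E N" "dominated_on E l N"
    and "f \<in> E"
  shows "extension E l f = l f"
  using extension_limit[OF assms(1-4) order_approx_self[OF assms(1,5)]]
  by (simp add: LIMSEQ_const_iff)

lemma extension_linear:
  assumes E: "subspace E" and l: "linear_functional_on E l" and N: "linear_functional_on E N"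
    and dom: "dominated_on E l N" and approx: "\<And>f. f \<in> C \<Longrightarrow> \<exists>g. order_approx E f g"
  shows "linear_functional_on C (extension E l)"
  unfolding linear_functional_on_def
proof (intro conjI ballI allI)
  note lim = extension_limit[OF E l N dom]
  fix f assume "f \<in> C"
  then obtain g where g: "order_approx E f g" using approx by blast
  { fix h assume "h \<in> C"
    then obtain k where k: "order_approx E h k" using approx by blast
    have "(\<lambda>j. l (g j + k j)) = (\<lambda>j. l (g j) + l (k j))"
      using linear_functional_on_add[OF l order_approx_mem[OF g] order_approx_mem[OF k]] by auto
    then show "extension E l (f + h) = extension E l f + extension E l h"
      using LIMSEQ_unique[OF lim[OF order_approx_add[OF E g k]]] tendsto_add[OF lim[OF g] lim[OF k]]
      by simp }
  fix c
  have "(\<lambda>j. l (c *\<^sub>R g j)) = (\<lambda>j. c * l (g j))"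
    using linear_functional_on_scale[OF l order_approx_mem[OF g]] by auto
  then show "extension E l (c *\<^sub>R f) = c * extension E l f"
    using LIMSEQ_unique[OF lim[OF order_approx_scale[OF E g]]] tendsto_mult_left[OF lim[OF g]]
    by simp
qed

section \<open>Compact supports and Radon measures\<close>

text \<open>Compactness of supports and the Stone-Weierstrass theorem require a Hausdorff space. The separation
  classes are declared from the weakest to the strongest, since an arity of a class must be at most as
  general as those of its superclasses.\<close>

lemma open_vimage_coordinate: "open V \<Longrightarrow> open ((\<lambda>h :: 'a \<Rightarrow> 'b::topological_space. h i) -` V)"
  using continuous_on_product_coordinates by (rule open_vimage[rotated])

instance "fun" :: (type, t0_space) t0_space
proof
  fix f g :: "'a \<Rightarrow> 'b"
  assume "f \<noteq> g"
  then obtain i where "f i \<noteq> g i" by (auto simp: fun_eq_iff)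
  then obtain S where "open S" "\<not> (f i \<in> S \<longleftrightarrow> g i \<in> S)"
    using separation_t0[of "f i" "g i"] by blast
  then show "\<exists>U. open U \<and> \<not> (f \<in> U \<longleftrightarrow> g \<in> U)"
    using open_vimage_coordinate[of S i] by (intro exI[of _ "(\<lambda>h. h i) -` S"]) auto
qed

instance "fun" :: (type, t1_space) t1_space
proof
  fix f g :: "'a \<Rightarrow> 'b"
  assume "f \<noteq> g"
  then obtain i where "f i \<noteq> g i" by (auto simp: fun_eq_iff)
  then obtain S where "open S" "f i \<in> S" "g i \<notin> S"
    using separation_t1[of "f i" "g i"] by blast
  then show "\<exists>U. open U \<and> f \<in> U \<and> g \<notin> U"
    using open_vimage_coordinate[of S i] by (intro exI[of _ "(\<lambda>h. h i) -` S"]) auto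
qed

instance "fun" :: (type, t2_space) t2_space
proof
  fix f g :: "'a \<Rightarrow> 'b"
  assume "f \<noteq> g"
  then obtain i where "f i \<noteq> g i" by (auto simp: fun_eq_iff)
  then obtain S T where "open S" "open T" "f i \<in> S" "g i \<in> T" "S \<inter> T = {}"
    using hausdorff[of "f i" "g i"] by blast
  then show "\<exists>U V. open U \<and> open V \<and> f \<in> U \<and> g \<in> V \<and> U \<inter> V = {}"
    using open_vimage_coordinate[of S i] open_vimage_coordinate[of T i]
    by (intro exI[of _ "(\<lambda>h. h i) -` S"] exI[of _ "(\<lambda>h. h i) -` T"]) auto
qed

lemma supp_in_subset_compact:
  fixes f :: "'a::t2_space \<Rightarrow> 'b::zero"
  assumes "compact K" "K \<subseteq> Y" "\<And>x. x \<in> Y \<Longrightarrow> f x \<noteq> 0 \<Longrightarrow> x \<in> K"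
  shows "supp_in Y f \<subseteq> K" "compact (supp_in Y f)"
proof -
  have sub: "closure {x \<in> Y. f x \<noteq> 0} \<subseteq> K"
    using assms compact_imp_closed by (intro closure_minimal) auto
  then show "supp_in Y f \<subseteq> K" unfolding supp_in_def by blast
  have "supp_in Y f = K \<inter> closure {x \<in> Y. f x \<noteq> 0}"
    using sub assms(2) unfolding supp_in_def by blast
  then show "compact (supp_in Y f)" using assms(1) by auto
qed

lemma supp_inI: "x \<in> Y \<Longrightarrow> f x \<noteq> 0 \<Longrightarrow> x \<in> supp_in Y f"
  unfolding supp_in_def using closure_subset by fastforce

lemma supp_in_subset: "supp_in Y f \<subseteq> Y"
  unfolding supp_in_def by blast

lemma CcD:
  assumes "f \<in> Cc Y"
  shows "continuous_on Y f" "\<And>x. x \<notin> Y \<Longrightarrow> f x = 0" "compact (supp_in Y f)"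
  using assms by (auto simp: Cc_def)

lemma CcI:
  fixes f :: "'a::t2_space \<Rightarrow> real"
  assumes "continuous_on Y f" "\<And>x. x \<notin> Y \<Longrightarrow> f x = 0"
    and "compact K" "K \<subseteq> Y" "\<And>x. x \<in> Y \<Longrightarrow> f x \<noteq> 0 \<Longrightarrow> x \<in> K"
  shows "f \<in> Cc Y"
  unfolding Cc_def using assms(1,2) supp_in_subset_compact(2)[OF assms(3-5)] by blast

lemma subspace_Cc: "subspace (Cc (Y :: 'a::t2_space set))"
proof (rule subspaceI)
  show "0 \<in> Cc Y" by (rule CcI[of _ _ "{}"]) (auto simp: zero_fun_def)
next
  fix f g assume f: "f \<in> Cc Y" and g: "g \<in> Cc Y"
  have "continuous_on Y (\<lambda>x. f x + g x)"
    by (intro continuous_intros CcD(1) f g)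
  then show "f + g \<in> Cc Y"
  proof (intro CcI[of _ _ "supp_in Y f \<union> supp_in Y g"])
    show "(f + g) x = 0" if "x \<notin> Y" for x
      using CcD(2)[OF f that] CcD(2)[OF g that] by simp
    show "x \<in> supp_in Y f \<union> supp_in Y g" if "x \<in> Y" "(f + g) x \<noteq> 0" for x
      using that supp_inI[of x Y f] supp_inI[of x Y g] by (cases "f x = 0") auto
    show "compact (supp_in Y f \<union> supp_in Y g)"
      by (intro compact_Un CcD(3) f g)
    show "supp_in Y f \<union> supp_in Y g \<subseteq> Y"
      by (intro Un_least supp_in_subset)
  qed (simp add: plus_fun_def)
next
  fix c f assume f: "f \<in> Cc Y"
  have "continuous_on Y (\<lambda>x. c * f x)"
    by (intro continuous_intros CcD(1) f)
  then show "c *\<^sub>R f \<in> Cc Y"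
  proof (intro CcI[of _ _ "supp_in Y f"])
    show "(c *\<^sub>R f) x = 0" if "x \<notin> Y" for x
      using CcD(2)[OF f that] by (simp add: scaleR_fun_def)
    show "x \<in> supp_in Y f" if "x \<in> Y" "(c *\<^sub>R f) x \<noteq> 0" for x
      using that supp_inI[of x Y f] by (simp add: scaleR_fun_def)
  qed (auto simp: scaleR_fun_def supp_in_subset intro: CcD(3) f)
qed

text \<open>The direct limit topology is the finest locally convex one, so the sets where \<open>\<bar>\<mu> v\<bar> < e\<close> are
  neighbourhoods of zero as soon as they are on each step, which is what the bound provides.\<close>

lemma radon_measureI:
  fixes Y :: "'a::t2_space set"
  assumes lin: "linear_functional_on (Cc Y) \<mu>"
    and bound: "\<And>K. compact K \<Longrightarrow> K \<subseteq> Y \<Longrightarrow> \<exists>c. \<forall>f\<in>Cc Y. supp_in Y f \<subseteq> K \<longrightarrow>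
      \<bar>\<mu> f\<bar> \<le> c * Sup (insert 0 ((\<lambda>x. \<bar>f x\<bar>) ` K))"
  shows "\<mu> \<in> radon_measures Y"
proof -
  let ?E = "Cc Y" and ?D = "Cc_steps Y"
  have add: "\<mu> (f + g) = \<mu> f + \<mu> g" if "f \<in> ?E" "g \<in> ?E" for f g
    using lin that unfolding linear_functional_on_def by blast
  have scale: "\<mu> (c *\<^sub>R f) = c * \<mu> f" if "f \<in> ?E" for c f
    using lin that unfolding linear_functional_on_def by blast
  note in_E = subspace_add[OF subspace_Cc] subspace_scale[OF subspace_Cc]
  have nbhd: "lc_zero_nbhd ?E ?D {v \<in> ?E. \<bar>\<mu> v\<bar> < e}" if e: "e > 0" for e
    unfolding lc_zero_nbhd_def
  proof (intro conjI)
    show "convex {v \<in> ?E. \<bar>\<mu> v\<bar> < e}"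
    proof (rule convexI)
      fix v w and a b :: real
      assume v: "v \<in> {v \<in> ?E. \<bar>\<mu> v\<bar> < e}" and w: "w \<in> {v \<in> ?E. \<bar>\<mu> v\<bar> < e}"
        and ab: "0 \<le> a" "0 \<le> b" "a + b = 1"
      have "\<bar>a * \<mu> v + b * \<mu> w\<bar> \<le> a * \<bar>\<mu> v\<bar> + b * \<bar>\<mu> w\<bar>"
        using abs_triangle_ineq[of "a * \<mu> v" "b * \<mu> w"] ab by (simp add: abs_mult)
      also have "\<dots> < e" using v w ab by (intro convex_bound_lt) auto
      finally show "a *\<^sub>R v + b *\<^sub>R w \<in> {v \<in> ?E. \<bar>\<mu> v\<bar> < e}"
        using v w by (auto simp: in_E add scale)
    qed
    show "\<forall>v\<in>{v \<in> ?E. \<bar>\<mu> v\<bar> < e}. \<forall>c. \<bar>c\<bar> \<le> 1 \<longrightarrow> c *\<^sub>R v \<in> {v \<in> ?E. \<bar>\<mu> v\<bar> < e}"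
    proof clarsimp
      fix v c assume v: "v \<in> ?E" "\<bar>\<mu> v\<bar> < e" "\<bar>c::real\<bar> \<le> 1"
      have "\<bar>c\<bar> * \<bar>\<mu> v\<bar> \<le> 1 * \<bar>\<mu> v\<bar>" using v(3) by (rule mult_right_mono) simp
      then show "c *\<^sub>R v \<in> ?E \<and> \<bar>\<mu> (c *\<^sub>R v)\<bar> < e"
        using v by (simp add: in_E scale abs_mult)
    qed
    show "\<forall>(F, \<nu>)\<in>?D. \<exists>m. \<exists>\<delta>>0. {v \<in> F. \<forall>k\<le>m. \<nu> k v < \<delta>} \<subseteq> {v \<in> ?E. \<bar>\<mu> v\<bar> < e}"
    proof clarify
      fix F \<nu> assume "(F, \<nu>) \<in> ?D"
      then obtain K where K: "compact K" "K \<subseteq> Y" "F = {f \<in> ?E. supp_in Y f \<subseteq> K}"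
        "\<nu> = (\<lambda>_ f. Sup (insert 0 ((\<lambda>x. \<bar>f x\<bar>) ` K)))"
        unfolding Cc_steps_def by blast
      obtain c where c: "\<And>f. f \<in> ?E \<Longrightarrow> supp_in Y f \<subseteq> K \<Longrightarrow>
          \<bar>\<mu> f\<bar> \<le> c * Sup (insert 0 ((\<lambda>x. \<bar>f x\<bar>) ` K))"
        using bound[OF K(1,2)] by blast
      let ?d = "e / (\<bar>c\<bar> + 1)"
      have "\<bar>\<mu> v\<bar> < e" if v: "v \<in> ?E" "supp_in Y v \<subseteq> K"
        and small: "Sup (insert 0 ((\<lambda>x. \<bar>v x\<bar>) ` K)) < ?d" for v
      proof -
        let ?s = "Sup (insert 0 ((\<lambda>x. \<bar>v x\<bar>) ` K))"
        have "continuous_on K (\<lambda>x. \<bar>v x\<bar>)"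
          using v(1) K(2) by (intro continuous_intros) (auto simp: Cc_def intro: continuous_on_subset)
        then have "bdd_above ((\<lambda>x. \<bar>v x\<bar>) ` K)"
          using K(1) by (intro bounded_imp_bdd_above compact_imp_bounded compact_continuous_image)
        then have s0: "0 \<le> ?s" by (intro cSup_upper) auto
        have "\<bar>\<mu> v\<bar> \<le> c * ?s" using c v by blast
        also have "\<dots> \<le> (\<bar>c\<bar> + 1) * ?s" using s0 by (intro mult_right_mono) auto
        also have "\<dots> < (\<bar>c\<bar> + 1) * ?d" using small by (intro mult_strict_left_mono) auto
        also have "\<dots> = e" by (simp add: field_simps add_nonneg_eq_0_iff)
        finally show ?thesis .
      qed
      moreover have "?d > 0" using e by (intro divide_pos_pos) auto
      ultimately show "\<exists>m. \<exists>\<delta>>0. {v \<in> F. \<forall>k\<le>m. \<nu> k v < \<delta>} \<subseteq> {v \<in> ?E. \<bar>\<mu> v\<bar> < e}"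
        unfolding K(3,4) by (intro exI[of _ 0] exI[of _ ?d]) auto
    qed
  qed auto
  have open_pre: "openin (lc_limit_topology ?E ?D) {v \<in> ?E. \<mu> v \<in> S}" if "open S" for S
    unfolding openin_lc_limit_topology
  proof (intro conjI ballI)
    fix w assume w: "w \<in> {v \<in> ?E. \<mu> v \<in> S}"
    then obtain e where e: "e > 0" "ball (\<mu> w) e \<subseteq> S"
      using \<open>open S\<close> open_contains_ball by blast
    have "(\<lambda>v. w + v) ` {v \<in> ?E. \<bar>\<mu> v\<bar> < e} \<subseteq> {v \<in> ?E. \<mu> v \<in> S}"
      using w e(2) by (auto simp: in_E add dist_real_def subset_iff)
    then show "\<exists>C. lc_zero_nbhd ?E ?D C \<and> (\<lambda>v. w + v) ` C \<subseteq> {v \<in> ?E. \<mu> v \<in> S}"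
      using nbhd[OF e(1)] by blast
  qed auto
  have "topspace (lc_limit_topology ?E ?D) = ?E"
  proof
    show "topspace (lc_limit_topology ?E ?D) \<subseteq> ?E"
      using openin_topspace[of "lc_limit_topology ?E ?D"] unfolding openin_lc_limit_topology by blast
    show "?E \<subseteq> topspace (lc_limit_topology ?E ?D)"
      using openin_subset[OF open_pre[OF open_UNIV]] by simp
  qed
  then have "continuous_map (lc_limit_topology ?E ?D) euclideanreal \<mu>"
    unfolding continuous_map_def using open_pre by auto
  then show ?thesis
    unfolding radon_measures_def cont_functionals_def using add scale by auto
qed

section \<open>Flat functions of one real variable\<close>

text \<open>The factors \<open>t\<^bsup>-m\<^esup>\<close> are carried along so that the derivatives of \<open>exp (-1/t)\<close> remain in the
  family.\<close>

definition flat :: "nat \<Rightarrow> real \<Rightarrow> real"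
  where "flat m t = (if t \<le> 0 then 0 else inverse t ^ m * exp (- inverse t))"

lemma flat_eq_0 [simp]: "t \<le> 0 \<Longrightarrow> flat m t = 0"
  by (simp add: flat_def)

lemma flat_pos: "0 < t \<Longrightarrow> 0 < flat m t"
  by (simp add: flat_def)

lemma flat_nonneg: "0 \<le> flat m t"
  by (simp add: flat_def)

lemma flat_0_strict_mono: "0 \<le> s \<Longrightarrow> s < t \<Longrightarrow> flat 0 s < flat 0 t"
  by (cases "s = 0") (auto simp: flat_def)

lemma flat_tendsto_0: "(flat m \<longlongrightarrow> 0) (at 0)"
proof -
  have "((\<lambda>t. inverse t ^ m / exp (inverse t)) \<longlongrightarrow> (0::real)) (at_right 0)"
    by (rule filterlim_compose[OF tendsto_power_div_exp_0 filterlim_inverse_at_top_right])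
  moreover have "\<forall>\<^sub>F t in at_right 0. inverse t ^ m / exp (inverse t) = flat m t"
    using eventually_at_right_less by eventually_elim (simp add: flat_def exp_minus field_simps)
  ultimately have right: "(flat m \<longlongrightarrow> 0) (at_right 0)"
    by (rule Lim_transform_eventually)
  have "\<forall>\<^sub>F t in at_left (0::real). 0 = flat m t"
    unfolding eventually_at_filter by auto
  then have "(flat m \<longlongrightarrow> 0) (at_left 0)"
    by (rule Lim_transform_eventually[OF tendsto_const])
  with right show ?thesis
    by (simp add: filterlim_split_at)
qed

text \<open>At \<open>t = 0\<close> the difference quotient of \<open>flat m\<close> is \<open>flat (m + 1)\<close>, which tends to \<open>0\<close>.\<close>

lemma has_real_derivative_flat:
  "(flat m has_real_derivative (flat (m + 2) t - real m * flat (m + 1) t)) (at t)"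
proof (rule linorder_cases[of t 0])
  assume t: "t < 0"
  have "\<forall>\<^sub>F s in nhds t. s < 0" using eventually_nhds_in_open[of "{..<0}" t] t by simp
  then have "\<forall>\<^sub>F s in nhds t. flat m s = 0" by eventually_elim simp
  then show ?thesis using t by (subst DERIV_cong_ev[where g = "\<lambda>_. 0"]) auto
next
  assume t: "t = 0"
  have "((\<lambda>h. flat (m + 1) h) \<longlongrightarrow> 0) (at 0)" by (rule flat_tendsto_0)
  then have "((\<lambda>h. (flat m (0 + h) - flat m 0) / h) \<longlongrightarrow> 0) (at 0)"
    by (rule Lim_transform_eventually) (auto simp: flat_def field_simps eventually_at_filter)
  then show ?thesis using t by (simp add: DERIV_def)
next
  assume t: "0 < t"
  have "((\<lambda>s. inverse s ^ m * exp (- inverse s)) has_real_derivative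
      (flat (m + 2) t - real m * flat (m + 1) t)) (at t)"
  proof -
    let ?u = "inverse t"
    have "((\<lambda>u. u ^ m * exp (- u)) has_real_derivative
        (real m * ?u ^ (m - 1) * exp (- ?u) - ?u ^ m * exp (- ?u))) (at ?u)"
      by (auto intro!: derivative_eq_intros)
    moreover have "(inverse has_real_derivative - (?u ^ 2)) (at t)"
      using DERIV_inverse[of t] t by (simp add: numeral_2_eq_2)
    ultimately have "((\<lambda>s. inverse s ^ m * exp (- inverse s)) has_real_derivative
        (real m * ?u ^ (m - 1) * exp (- ?u) - ?u ^ m * exp (- ?u)) * - (?u ^ 2)) (at t)"
      by (rule DERIV_chain2)
    moreover have "(real m * ?u ^ (m - 1) * exp (- ?u) - ?u ^ m * exp (- ?u)) * - (?u ^ 2)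
        = flat (m + 2) t - real m * flat (m + 1) t"
      using t by (cases m) (simp_all add: flat_def power2_eq_square algebra_simps)
    ultimately show ?thesis by simp
  qed
  moreover have "\<forall>\<^sub>F s in nhds t. flat m s = inverse s ^ m * exp (- inverse s)"
  proof -
    have "\<forall>\<^sub>F s in nhds t. 0 < s" using eventually_nhds_in_open[of "{0<..}" t] t by simp
    then show ?thesis by eventually_elim (simp add: flat_def)
  qed
  ultimately show ?thesis by (subst DERIV_cong_ev) auto
qed

lemma continuous_on_flat [continuous_intros]:
  "continuous_on S f \<Longrightarrow> continuous_on S (\<lambda>x. flat m (f x))"
  using continuous_on_compose2[of UNIV "flat m" S f] has_real_derivative_flat[THEN DERIV_isCont]
  by (auto simp: continuous_at_imp_continuous_on)


section \<open>An algebra of smooth functions on \<open>\<real>\<^sub>\<infinity>\<^sup>n\<close>\<close>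

text \<open>Composition with \<open>flat m\<close> is a closure rule because the generators only provide functions that vanish
  for large \<open>u\<^sub>i\<close>: a function that vanishes for \<open>u\<^sub>i \<le> a\<close> and is positive up to \<open>u\<^sub>i = \<infinity>\<close> arises as
  \<open>flat 0\<close> of a constant minus a generator. The value \<open>0\<close> of a generator at \<open>u\<^sub>i = -\<infinity>\<close> lies outside
  \<open>\<real>\<^sub>\<infinity>\<^sup>n\<close>; it makes the algebra closed under \<open>pd\<close> on the whole type.\<close>

inductive_set flat_algebra :: "nat \<Rightarrow> (point \<Rightarrow> real) set" for n where
  const: "(\<lambda>_. c) \<in> flat_algebra n"
| coord: "i \<in> {1..n} \<Longrightarrow>
    (\<lambda>x. if \<bar>x i\<bar> = \<infinity> then 0 else flat m (b - real_of_ereal (x i))) \<in> flat_algebra n"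
| add: "f \<in> flat_algebra n \<Longrightarrow> g \<in> flat_algebra n \<Longrightarrow> (\<lambda>x. f x + g x) \<in> flat_algebra n"
| mult: "f \<in> flat_algebra n \<Longrightarrow> g \<in> flat_algebra n \<Longrightarrow> (\<lambda>x. f x * g x) \<in> flat_algebra n"
| flat: "f \<in> flat_algebra n \<Longrightarrow> (\<lambda>x. flat m (f x)) \<in> flat_algebra n"

lemma flat_algebra_prod:
  "finite A \<Longrightarrow> (\<And>i. i \<in> A \<Longrightarrow> f i \<in> flat_algebra n) \<Longrightarrow> (\<lambda>x. \<Prod>i\<in>A. f i x) \<in> flat_algebra n"
  by (induction A rule: finite_induct) (auto intro: flat_algebra.intros)

lemma flat_algebra_sum:
  "finite A \<Longrightarrow> (\<And>i. i \<in> A \<Longrightarrow> f i \<in> flat_algebra n) \<Longrightarrow> (\<lambda>x. \<Sum>i\<in>A. f i x) \<in> flat_algebra n"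
  by (induction A rule: finite_induct) (auto intro: flat_algebra.intros)

text \<open>The chain rule at \<open>flat m\<close> brings in only \<open>flat (m + 1)\<close> and \<open>flat (m + 2)\<close>, so the derivatives
  are again in the algebra. Smoothness of all orders then follows by iteration.\<close>

lemma flat_algebra_partial_derivative:
  assumes "f \<in> flat_algebra n"
  shows "\<exists>f'\<in>flat_algebra n. (\<forall>x. \<bar>x i\<bar> = \<infinity> \<longrightarrow> f' x = 0) \<and>
    (\<forall>x t. ((\<lambda>t. f (x(i := ereal t))) has_real_derivative f' (x(i := ereal t))) (at t))"
  using assms
proof induction
  case (const c)
  show ?case by (intro bexI[of _ "\<lambda>_. 0"] flat_algebra.intros) auto
next
  case (coord j m b)
  let ?e = "\<lambda>m x. if \<bar>x j\<bar> = \<infinity> then 0 else flat m (b - real_of_ereal (x j))"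
  show ?case
  proof (cases "i = j")
    case True
    let ?f' = "\<lambda>x. (-1) * ?e (m + 2) x + real m * ?e (m + 1) x"
    have "?f' \<in> flat_algebra n"
      by (intro flat_algebra.intros coord)
    moreover have "((\<lambda>t. ?e m (x(i := ereal t))) has_real_derivative ?f' (x(i := ereal t))) (at t)" for x t
    proof -
      have "((\<lambda>t. flat m (b - t)) has_real_derivative
          (flat (m + 2) (b - t) - real m * flat (m + 1) (b - t)) * (-1)) (at t)"
        by (rule DERIV_chain2[OF has_real_derivative_flat]) (auto intro!: derivative_eq_intros)
      then show ?thesis by (simp add: True)
    qed
    ultimately show ?thesis using True by (intro bexI[of _ ?f']) auto
  next
    case False
    then show ?thesis
      by (intro bexI[of _ "\<lambda>_. 0"] flat_algebra.intros) (auto cong: if_cong)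
  qed
next
  case (add f g)
  then obtain f' g' where
    f': "f' \<in> flat_algebra n" "\<And>x. \<bar>x i\<bar> = \<infinity> \<Longrightarrow> f' x = 0"
      "\<And>x t. ((\<lambda>t. f (x(i := ereal t))) has_real_derivative f' (x(i := ereal t))) (at t)"
    and g': "g' \<in> flat_algebra n" "\<And>x. \<bar>x i\<bar> = \<infinity> \<Longrightarrow> g' x = 0"
      "\<And>x t. ((\<lambda>t. g (x(i := ereal t))) has_real_derivative g' (x(i := ereal t))) (at t)"
    by blast
  show ?case
  proof (intro bexI[of _ "\<lambda>x. f' x + g' x"] conjI allI impI)
    show "(\<lambda>x. f' x + g' x) \<in> flat_algebra n"
      by (intro flat_algebra.intros f' g')
    show "((\<lambda>t. f (x(i := ereal t)) + g (x(i := ereal t))) has_real_derivative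
        f' (x(i := ereal t)) + g' (x(i := ereal t))) (at t)" for x t
      by (rule DERIV_add[OF f'(3) g'(3)])
  qed (simp add: f'(2) g'(2))
next
  case (mult f g)
  then obtain f' g' where
    f': "f' \<in> flat_algebra n" "\<And>x. \<bar>x i\<bar> = \<infinity> \<Longrightarrow> f' x = 0"
      "\<And>x t. ((\<lambda>t. f (x(i := ereal t))) has_real_derivative f' (x(i := ereal t))) (at t)"
    and g': "g' \<in> flat_algebra n" "\<And>x. \<bar>x i\<bar> = \<infinity> \<Longrightarrow> g' x = 0"
      "\<And>x t. ((\<lambda>t. g (x(i := ereal t))) has_real_derivative g' (x(i := ereal t))) (at t)"
    by blast
  show ?case
  proof (intro bexI[of _ "\<lambda>x. f' x * g x + g' x * f x"] conjI allI impI)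
    show "(\<lambda>x. f' x * g x + g' x * f x) \<in> flat_algebra n"
      by (intro flat_algebra.intros f' g' mult.hyps)
    show "((\<lambda>t. f (x(i := ereal t)) * g (x(i := ereal t))) has_real_derivative
        f' (x(i := ereal t)) * g (x(i := ereal t)) + g' (x(i := ereal t)) * f (x(i := ereal t))) (at t)" for x t
      by (rule DERIV_mult[OF f'(3) g'(3)])
  qed (simp add: f'(2) g'(2))
next
  case (flat f m)
  then obtain f' where
    f': "f' \<in> flat_algebra n" "\<And>x. \<bar>x i\<bar> = \<infinity> \<Longrightarrow> f' x = 0"
      "\<And>x t. ((\<lambda>t. f (x(i := ereal t))) has_real_derivative f' (x(i := ereal t))) (at t)"
    by blast
  let ?h = "\<lambda>x. (flat (m + 2) (f x) + (- real m) * flat (m + 1) (f x)) * f' x"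
  have "?h \<in> flat_algebra n"
    by (intro flat_algebra.intros f' flat.hyps)
  moreover have "((\<lambda>t. flat m (f (x(i := ereal t)))) has_real_derivative ?h (x(i := ereal t))) (at t)" for x t
    using DERIV_chain2[OF has_real_derivative_flat f'(3)] by simp
  moreover have "?h x = 0" if "\<bar>x i\<bar> = \<infinity>" for x
    using f'(2)[of x] that by simp
  ultimately show ?case
    by (intro bexI[of _ ?h] conjI allI impI)
qed

lemma ereal_update_id: "\<bar>x i\<bar> \<noteq> \<infinity> \<Longrightarrow> x(i := ereal (real_of_ereal (x i))) = x"
  by (simp add: ereal_real')

lemma flat_algebra_pd:
  assumes "f \<in> flat_algebra n"
  shows "pd i f \<in> flat_algebra n"
proof -
  obtain f' where f': "f' \<in> flat_algebra n" "\<And>x. \<bar>x i\<bar> = \<infinity> \<Longrightarrow> f' x = 0"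
      "\<And>x t. ((\<lambda>t. f (x(i := ereal t))) has_real_derivative f' (x(i := ereal t))) (at t)"
    using flat_algebra_partial_derivative[OF assms, of i] by blast
  have "pd i f x = f' x" for x
    using f'(2)[of x] DERIV_imp_deriv[OF f'(3)[of x "real_of_ereal (x i)"]] ereal_update_id[of x i]
    by (auto simp: pd_def)
  then have "pd i f = f'" by blast
  with f'(1) show ?thesis by simp
qed

lemma flat_algebra_foldr_pd: "f \<in> flat_algebra n \<Longrightarrow> foldr pd is f \<in> flat_algebra n"
  by (induction "is") (auto intro: flat_algebra_pd)

lemma flat_algebra_differentiable:
  "f \<in> flat_algebra n \<Longrightarrow> (\<lambda>t. f (x(i := ereal t))) differentiable at t"
  using flat_algebra_partial_derivative[of f n i] real_differentiable_def by blast

lemma continuous_on_coordinate [continuous_intros]: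
  "continuous_on S (\<lambda>x :: 'i \<Rightarrow> 'a::topological_space. x i)"
  by (rule continuous_on_subset[OF continuous_on_product_coordinates]) simp

lemma flat_algebra_continuous:
  assumes "f \<in> flat_algebra n"
  shows "continuous_on (Rinf n) f"
  using assms
proof induction
  case (coord i m b)
  \<comment> \<open>Truncating at \<open>b\<close> changes nothing, since \<open>flat m\<close> vanishes on negative numbers, and keeps the
    coordinate finite.\<close>
  let ?r = "\<lambda>x. real_of_ereal (min (x i) (ereal b))"
  have "continuous_on (Rinf n) (\<lambda>x. min (x i) (ereal b))"
    by (intro continuous_intros)
  moreover have "\<bar>min (x i) (ereal b)\<bar> \<noteq> \<infinity>" if "x \<in> Rinf n" for x
    using that coord by (cases "x i") (auto simp: Rinf_def PiE_def Pi_def min_def)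
  ultimately have "continuous_on (Rinf n) ?r"
    unfolding continuous_on_def by (auto intro!: lim_real_of_ereal simp: ereal_real')
  then have "continuous_on (Rinf n) (\<lambda>x. flat m (b - ?r x))"
    by (intro continuous_intros)
  moreover have "flat m (b - ?r x) = (if \<bar>x i\<bar> = \<infinity> then 0 else flat m (b - real_of_ereal (x i)))"
    if "x \<in> Rinf n" for x
    using that coord by (cases "x i") (auto simp: Rinf_def PiE_def Pi_def min_def)
  ultimately show ?case
    using continuous_on_cong[OF refl] by fastforce
qed (auto intro: continuous_intros)

text \<open>A generator in a coordinate that is infinite at \<open>x\<close> vanishes on \<open>u\<^sub>i > b\<close>, hence near \<open>x\<close>; the other
  coordinates are unchanged by \<open>to_stratum\<close>.\<close>

lemma flat_algebra_locally_pullback: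
  assumes "f \<in> flat_algebra n" "L = infs n x"
  shows "\<exists>V. open V \<and> x \<in> V \<and> (\<forall>y\<in>V. f (to_stratum L y) = f y)"
  using assms(1)
proof induction
  case (const c)
  show ?case by (intro exI[of _ UNIV]) auto
next
  case (coord i m b)
  show ?case
  proof (cases "i \<in> L")
    case True
    let ?V = "{y::point. ereal b < y i}"
    have "open ?V" by (intro open_Collect_less continuous_intros)
    moreover have "x \<in> ?V" using True assms(2) by (auto simp: infs_def)
    moreover have "flat m (b - real_of_ereal (y i)) = 0" if "ereal b < y i" "\<bar>y i\<bar> \<noteq> \<infinity>" for y :: point
      using that by (cases "y i") auto
    ultimately show ?thesis using True by (intro exI[of _ ?V]) (auto simp: to_stratum_def)
  next
    case False
    then show ?thesis by (intro exI[of _ UNIV]) (auto simp: to_stratum_def)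
  qed
next
  case (add f g)
  then obtain V W where "open V" "x \<in> V" "\<forall>y\<in>V. f (to_stratum L y) = f y"
    "open W" "x \<in> W" "\<forall>y\<in>W. g (to_stratum L y) = g y" by blast
  then show ?case by (intro exI[of _ "V \<inter> W"]) auto
next
  case (mult f g)
  then obtain V W where "open V" "x \<in> V" "\<forall>y\<in>V. f (to_stratum L y) = f y"
    "open W" "x \<in> W" "\<forall>y\<in>W. g (to_stratum L y) = g y" by blast
  then show ?case by (intro exI[of _ "V \<inter> W"]) auto
next
  case (flat f m)
  then show ?case by metis
qed

section \<open>Smooth functions and Lagerberg forms\<close>

lemma Rinf_update: "x \<in> Rinf n \<Longrightarrow> i \<in> {1..n} \<Longrightarrow> x(i := ereal t) \<in> Rinf n"
  unfolding Rinf_def by (auto simp: PiE_def Pi_def extensional_def)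

lemma stratum_update:
  assumes "x \<in> stratum n L" "i \<in> {1..n} - L"
  shows "x(i := ereal t) \<in> stratum n L"
  using assms Rinf_update[of x n i t] by (auto simp: stratum_def infs_def)

lemma stratum_finite_coordinate:
  assumes "x \<in> stratum n L" "i \<in> {1..n} - L"
  shows "\<bar>x i\<bar> \<noteq> \<infinity>"
  using assms by (cases "x i") (auto simp: stratum_def infs_def Rinf_def PiE_def Pi_def)

text \<open>A relatively open part of a stratum contains a short segment in each coordinate direction of the
  stratum. Hence partial derivatives along the stratum only depend on values there, and iterated ones can be
  compared by induction.\<close>

lemma eventually_update_in_stratum:
  assumes U: "openin (top_of_set (Rinf n)) U" and x: "x \<in> U \<inter> stratum n L" and i: "i \<in> {1..n} - L"
  shows "\<forall>\<^sub>F t in nhds (real_of_ereal (x i)). x(i := ereal t) \<in> U \<inter> stratum n L"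
proof -
  obtain S where S: "open S" "U = S \<inter> Rinf n"
    using U by (auto simp: openin_open)
  have id: "x(i := ereal (real_of_ereal (x i))) = x"
    using x i by (intro ereal_update_id stratum_finite_coordinate[of x n L]) auto
  have "continuous_on UNIV (\<lambda>t. x(i := ereal t))"
  proof (rule continuous_on_coordinatewise_then_product)
    show "continuous_on UNIV (\<lambda>t. (x(i := ereal t)) j)" for j
      by (cases "j = i") (auto intro!: continuous_intros)
  qed
  then have "open ((\<lambda>t. x(i := ereal t)) -` S)"
    using S(1) by (rule open_vimage[rotated])
  moreover have "real_of_ereal (x i) \<in> (\<lambda>t. x(i := ereal t)) -` S"
    using id x S(2) by simp
  ultimately have "\<forall>\<^sub>F t in nhds (real_of_ereal (x i)). t \<in> (\<lambda>t. x(i := ereal t)) -` S"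
    by (rule eventually_nhds_in_open)
  then show ?thesis
  proof (rule eventually_mono)
    fix t assume "t \<in> (\<lambda>t. x(i := ereal t)) -` S"
    then show "x(i := ereal t) \<in> U \<inter> stratum n L"
      using stratum_update[of x n L i t] x i S(2) by (auto simp: stratum_def)
  qed
qed

lemma foldr_pd_cong:
  assumes U: "openin (top_of_set (Rinf n)) U" and "set is \<subseteq> {1..n} - L"
    and eq: "\<And>x. x \<in> U \<inter> stratum n L \<Longrightarrow> f x = g x" and "x \<in> U \<inter> stratum n L"
  shows "foldr pd is f x = foldr pd is g x"
  using assms(2,4)
proof (induction "is" arbitrary: x)
  case Nil
  then show ?case using eq by simp
next
  case (Cons i "is")
  have ev: "\<forall>\<^sub>F t in nhds (real_of_ereal (x i)). x(i := ereal t) \<in> U \<inter> stratum n L"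
    using eventually_update_in_stratum[OF U] Cons.prems by auto
  have "\<forall>\<^sub>F t in nhds (real_of_ereal (x i)).
      foldr pd is f (x(i := ereal t)) = foldr pd is g (x(i := ereal t))"
    using ev by (rule eventually_mono) (use Cons in auto)
  then have "deriv (\<lambda>t. foldr pd is f (x(i := ereal t))) (real_of_ereal (x i))
      = deriv (\<lambda>t. foldr pd is g (x(i := ereal t))) (real_of_ereal (x i))"
    by (intro deriv_cong_ev refl)
  then show ?case
    by (simp add: pd_def[of i])
qed

lemma smooth_on_stratum_cong:
  assumes U: "openin (top_of_set (Rinf n)) U"
    and eq: "\<And>x. x \<in> U \<inter> stratum n L \<Longrightarrow> f x = g x"
    and f: "smooth_on_stratum n L (U \<inter> stratum n L) f"
  shows "smooth_on_stratum n L (U \<inter> stratum n L) g"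
  unfolding smooth_on_stratum_def
proof (intro allI impI conjI ballI)
  fix "is" assume "is": "set is \<subseteq> {1..n} - L"
  have same: "foldr pd is f x = foldr pd is g x" if "x \<in> U \<inter> stratum n L" for x
    by (rule foldr_pd_cong[OF U "is" eq that])
  have "continuous_on (U \<inter> stratum n L) (foldr pd is f)"
    using f "is" unfolding smooth_on_stratum_def by blast
  then show "continuous_on (U \<inter> stratum n L) (foldr pd is g)"
    by (rule continuous_on_eq) (rule same)
  fix x i assume x: "x \<in> U \<inter> stratum n L" and i: "i \<in> {1..n} - L"
  let ?t = "real_of_ereal (x i)"
  have "(\<lambda>t. foldr pd is f (x(i := ereal t))) differentiable at ?t"
    using f "is" x i unfolding smooth_on_stratum_def by blast
  then obtain D where D: "((\<lambda>t. foldr pd is f (x(i := ereal t))) has_real_derivative D) (at ?t)"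
    unfolding real_differentiable_def by blast
  have "\<forall>\<^sub>F t in nhds ?t. foldr pd is f (x(i := ereal t)) = foldr pd is g (x(i := ereal t))"
    using eventually_update_in_stratum[OF U x i] by (rule eventually_mono) (rule same)
  then have "((\<lambda>t. foldr pd is g (x(i := ereal t))) has_real_derivative D) (at ?t)"
    using DERIV_cong_ev[OF refl _ refl, THEN iffD1, OF _ D] by simp
  then show "(\<lambda>t. foldr pd is g (x(i := ereal t))) differentiable at ?t"
    unfolding real_differentiable_def by blast
qed

text \<open>Since \<open>deriv\<close> has an arbitrary value at points of non-differentiability, linearity holds only for
  smooth functions, and only on the set where they are smooth.\<close>

lemma foldr_pd_combination:
  assumes U: "openin (top_of_set (Rinf n)) U"
    and f: "smooth_on_stratum n L (U \<inter> stratum n L) f"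
    and g: "smooth_on_stratum n L (U \<inter> stratum n L) g"
    and "set is \<subseteq> {1..n} - L" "x \<in> U \<inter> stratum n L"
  shows "foldr pd is (\<lambda>x. a * f x + b * g x) x = a * foldr pd is f x + b * foldr pd is g x"
  using assms(4,5)
proof (induction "is" arbitrary: x)
  case Nil
  then show ?case by simp
next
  case (Cons i "is")
  let ?t = "real_of_ereal (x i)"
  have i: "i \<in> {1..n} - L" and "is": "set is \<subseteq> {1..n} - L"
    using Cons.prems by auto
  have "(\<lambda>t. foldr pd is f (x(i := ereal t))) differentiable at ?t"
    "(\<lambda>t. foldr pd is g (x(i := ereal t))) differentiable at ?t"
    using f g "is" i Cons.prems(2) unfolding smooth_on_stratum_def by blast+
  then obtain D D' where D: "((\<lambda>t. foldr pd is f (x(i := ereal t))) has_real_derivative D) (at ?t)"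
    and D': "((\<lambda>t. foldr pd is g (x(i := ereal t))) has_real_derivative D') (at ?t)"
    unfolding real_differentiable_def by blast
  have "\<forall>\<^sub>F t in nhds ?t. foldr pd is (\<lambda>x. a * f x + b * g x) (x(i := ereal t))
      = a * foldr pd is f (x(i := ereal t)) + b * foldr pd is g (x(i := ereal t))"
    using eventually_update_in_stratum[OF U Cons.prems(2) i] by (rule eventually_mono) (rule Cons.IH[OF "is"])
  then have "deriv (\<lambda>t. foldr pd is (\<lambda>x. a * f x + b * g x) (x(i := ereal t))) ?t
      = deriv (\<lambda>t. a * foldr pd is f (x(i := ereal t)) + b * foldr pd is g (x(i := ereal t))) ?t"
    by (intro deriv_cong_ev refl)
  also have "\<dots> = a * deriv (\<lambda>t. foldr pd is f (x(i := ereal t))) ?t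
      + b * deriv (\<lambda>t. foldr pd is g (x(i := ereal t))) ?t"
    using DERIV_imp_deriv[OF DERIV_add[OF DERIV_cmult[OF D, of a] DERIV_cmult[OF D', of b]]]
      DERIV_imp_deriv[OF D] DERIV_imp_deriv[OF D'] by simp
  finally show ?case
    using stratum_finite_coordinate[of x n L i] Cons.prems(2) i by (simp add: pd_def[of i])
qed

lemma smooth_on_stratum_combination:
  assumes U: "openin (top_of_set (Rinf n)) U"
    and f: "smooth_on_stratum n L (U \<inter> stratum n L) f"
    and g: "smooth_on_stratum n L (U \<inter> stratum n L) g"
  shows "smooth_on_stratum n L (U \<inter> stratum n L) (\<lambda>x. a * f x + b * g x)"
  unfolding smooth_on_stratum_def
proof (intro allI impI conjI ballI)
  fix "is" assume "is": "set is \<subseteq> {1..n} - L"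
  have same: "a * foldr pd is f x + b * foldr pd is g x = foldr pd is (\<lambda>x. a * f x + b * g x) x"
    if "x \<in> U \<inter> stratum n L" for x
    by (rule foldr_pd_combination[OF U f g "is" that, symmetric])
  have cont: "continuous_on (U \<inter> stratum n L) (foldr pd is f)" "continuous_on (U \<inter> stratum n L) (foldr pd is g)"
    using f g "is" unfolding smooth_on_stratum_def by blast+
  have "continuous_on (U \<inter> stratum n L) (\<lambda>x. a * foldr pd is f x + b * foldr pd is g x)"
    by (intro continuous_intros cont)
  then show "continuous_on (U \<inter> stratum n L) (foldr pd is (\<lambda>x. a * f x + b * g x))"
    by (rule continuous_on_eq) (rule same)
  fix x i assume x: "x \<in> U \<inter> stratum n L" and i: "i \<in> {1..n} - L"
  let ?t = "real_of_ereal (x i)"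
  have "(\<lambda>t. foldr pd is f (x(i := ereal t))) differentiable at ?t"
    "(\<lambda>t. foldr pd is g (x(i := ereal t))) differentiable at ?t"
    using f g "is" x i unfolding smooth_on_stratum_def by blast+
  then obtain D D' where D: "((\<lambda>t. foldr pd is f (x(i := ereal t))) has_real_derivative D) (at ?t)"
    and D': "((\<lambda>t. foldr pd is g (x(i := ereal t))) has_real_derivative D') (at ?t)"
    unfolding real_differentiable_def by blast
  have ev: "\<forall>\<^sub>F t in nhds ?t. a * foldr pd is f (x(i := ereal t)) + b * foldr pd is g (x(i := ereal t))
      = foldr pd is (\<lambda>x. a * f x + b * g x) (x(i := ereal t))"
    using eventually_update_in_stratum[OF U x i] by (rule eventually_mono) (rule same)
  have "((\<lambda>t. a * foldr pd is f (x(i := ereal t)) + b * foldr pd is g (x(i := ereal t)))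
      has_real_derivative a * D + b * D') (at ?t)"
    by (intro DERIV_add DERIV_cmult D D')
  then have "((\<lambda>t. foldr pd is (\<lambda>x. a * f x + b * g x) (x(i := ereal t)))
      has_real_derivative a * D + b * D') (at ?t)"
    by (rule DERIV_cong_ev[OF refl ev refl, THEN iffD1])
  then show "(\<lambda>t. foldr pd is (\<lambda>x. a * f x + b * g x) (x(i := ereal t))) differentiable at ?t"
    unfolding real_differentiable_def by blast
qed

lemma foldr_pd_zero: "foldr pd is (\<lambda>_. 0) = (\<lambda>_. 0)"
  by (induction "is") (auto simp: pd_def)

lemma smooth_on_stratum_zero: "smooth_on_stratum n L W (\<lambda>_. 0)"
  by (simp add: smooth_on_stratum_def foldr_pd_zero)

lemma flat_algebra_smooth:
  assumes "f \<in> flat_algebra n" "U \<subseteq> Rinf n"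
  shows "smooth_on_stratum n L (U \<inter> stratum n L) f"
  unfolding smooth_on_stratum_def
proof (intro allI impI conjI ballI)
  fix "is"
  have f: "foldr pd is f \<in> flat_algebra n"
    by (rule flat_algebra_foldr_pd[OF assms(1)])
  show "continuous_on (U \<inter> stratum n L) (foldr pd is f)"
    using assms(2) by (intro continuous_on_subset[OF flat_algebra_continuous[OF f]]) auto
  show "(\<lambda>t. foldr pd is f (x(i := ereal t))) differentiable at (real_of_ereal (x i))" for x i
    by (rule flat_algebra_differentiable[OF f])
qed

lemma lag_formsD:
  assumes "\<omega> \<in> lag_forms n p q U"
  shows "\<And>x. x \<notin> U \<Longrightarrow> \<omega> x = 0"
    and "\<And>L x. L \<subseteq> {1..n} \<Longrightarrow> x \<in> U \<inter> stratum n L \<Longrightarrow> lval_of_type ({1..n} - L) p q (\<omega> x)"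
    and "\<And>L I J. L \<subseteq> {1..n} \<Longrightarrow> smooth_on_stratum n L (U \<inter> stratum n L) (\<lambda>x. \<omega> x I J)"
    and "\<And>L x. L \<subseteq> {1..n} \<Longrightarrow> x \<in> U \<inter> stratum n L \<Longrightarrow>
      \<exists>V. openin (top_of_set U) V \<and> x \<in> V \<and> compat_on n L V \<omega>"
proof -
  have 0: "\<forall>x. x \<notin> U \<longrightarrow> \<omega> x = 0"
    and 1: "\<forall>L\<subseteq>{1..n}. (\<forall>x \<in> U \<inter> stratum n L. lval_of_type ({1..n} - L) p q (\<omega> x)) \<and>
       (\<forall>I J. smooth_on_stratum n L (U \<inter> stratum n L) (\<lambda>x. \<omega> x I J)) \<and>
       (\<forall>x \<in> U \<inter> stratum n L. \<exists>V. openin (top_of_set U) V \<and> x \<in> V \<and> compat_on n L V \<omega>)"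
    using assms unfolding lag_forms_def mem_Collect_eq by (rule conjunct1, rule conjunct2)
  show "\<omega> x = 0" if "x \<notin> U" for x
    using 0 that by simp
  fix L assume "L \<subseteq> {1..n}"
  note 1 = 1[rule_format, OF this]
  show "lval_of_type ({1..n} - L) p q (\<omega> x)" if "x \<in> U \<inter> stratum n L" for x
    using 1[THEN conjunct1] that by (rule bspec)
  show "smooth_on_stratum n L (U \<inter> stratum n L) (\<lambda>x. \<omega> x I J)" for I J
    using 1[THEN conjunct2, THEN conjunct1] by simp
  show "\<exists>V. openin (top_of_set U) V \<and> x \<in> V \<and> compat_on n L V \<omega>" if "x \<in> U \<inter> stratum n L" for x
    using 1[THEN conjunct2, THEN conjunct2] that by (rule bspec)
qed

lemma lag_formsI:
  assumes "\<And>x. x \<notin> U \<Longrightarrow> \<omega> x = 0"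
    and "\<And>L x. L \<subseteq> {1..n} \<Longrightarrow> x \<in> U \<inter> stratum n L \<Longrightarrow> lval_of_type ({1..n} - L) p q (\<omega> x)"
    and "\<And>L I J. L \<subseteq> {1..n} \<Longrightarrow> smooth_on_stratum n L (U \<inter> stratum n L) (\<lambda>x. \<omega> x I J)"
    and "\<And>L x. L \<subseteq> {1..n} \<Longrightarrow> x \<in> U \<inter> stratum n L \<Longrightarrow>
      \<exists>V. openin (top_of_set U) V \<and> x \<in> V \<and> compat_on n L V \<omega>"
  shows "\<omega> \<in> lag_forms n p q U"
  unfolding lag_forms_def mem_Collect_eq by (intro conjI allI impI ballI assms)

lemma compat_onD:
  "compat_on n L V \<omega> \<Longrightarrow> L' \<subseteq> L \<Longrightarrow> y \<in> V \<inter> stratum n L' \<Longrightarrow>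
    to_stratum L y \<in> V \<inter> stratum n L \<Longrightarrow> \<omega> y = \<omega> (to_stratum L y)"
  unfolding compat_on_def by blast

lemma lag_forms_combination:
  assumes U: "openin (top_of_set (Rinf n)) U"
    and \<omega>: "\<omega> \<in> lag_forms n p q U" and \<eta>: "\<eta> \<in> lag_forms n p q U"
  shows "(\<lambda>x A B. a * \<omega> x A B + b * \<eta> x A B) \<in> lag_forms n p q U"
proof (rule lag_formsI)
  note D = lag_formsD[OF \<omega>] and D' = lag_formsD[OF \<eta>]
  show "(\<lambda>A B. a * \<omega> x A B + b * \<eta> x A B) = 0" if "x \<notin> U" for x
    using D(1)[OF that] D'(1)[OF that] by (simp add: zero_fun_def)
  fix L assume L: "L \<subseteq> {1..n}"
  show "smooth_on_stratum n L (U \<inter> stratum n L) (\<lambda>x. a * \<omega> x I J + b * \<eta> x I J)" for I J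
    by (intro smooth_on_stratum_combination U D(3) D'(3) L)
  fix x assume x: "x \<in> U \<inter> stratum n L"
  have "\<omega> x I J \<noteq> 0 \<or> \<eta> x I J \<noteq> 0" if "a * \<omega> x I J + b * \<eta> x I J \<noteq> 0" for I J
    using that by auto
  then show "lval_of_type ({1..n} - L) p q (\<lambda>A B. a * \<omega> x A B + b * \<eta> x A B)"
    using D(2)[OF L x] D'(2)[OF L x] unfolding lval_of_type_def by meson
  obtain V V' where V: "openin (top_of_set U) V" "x \<in> V" "compat_on n L V \<omega>"
    and V': "openin (top_of_set U) V'" "x \<in> V'" "compat_on n L V' \<eta>"
    using D(4)[OF L x] D'(4)[OF L x] by blast
  have "compat_on n L (V \<inter> V') (\<lambda>x A B. a * \<omega> x A B + b * \<eta> x A B)"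
    unfolding compat_on_def
  proof (intro allI impI ballI)
    fix L' y assume y: "L' \<subseteq> L" "y \<in> V \<inter> V' \<inter> stratum n L'" "to_stratum L y \<in> V \<inter> V' \<inter> stratum n L"
    have "\<omega> y = \<omega> (to_stratum L y)"
      by (rule compat_onD[OF V(3) y(1)]) (use y in auto)
    moreover have "\<eta> y = \<eta> (to_stratum L y)"
      by (rule compat_onD[OF V'(3) y(1)]) (use y in auto)
    ultimately show "(\<lambda>A B. a * \<omega> y A B + b * \<eta> y A B)
        = (\<lambda>A B. a * \<omega> (to_stratum L y) A B + b * \<eta> (to_stratum L y) A B)"
      by simp
  qed
  then show "\<exists>V. openin (top_of_set U) V \<and> x \<in> V \<and>
      compat_on n L V (\<lambda>x A B. a * \<omega> x A B + b * \<eta> x A B)"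
    by (intro exI[of _ "V \<inter> V'"] conjI openin_Int IntI V(1,2) V'(1,2))
qed

lemma lag_forms_cI:
  assumes "\<omega> \<in> lag_forms n p q U" "compact K" "K \<subseteq> U" "\<And>x. x \<in> U \<Longrightarrow> \<omega> x \<noteq> 0 \<Longrightarrow> x \<in> K"
  shows "\<omega> \<in> lag_forms_c n p q U"
  unfolding lag_forms_c_def using assms(1) supp_in_subset_compact(2)[OF assms(2-4)] by blast

lemma lag_forms_c_combination:
  assumes U: "openin (top_of_set (Rinf n)) U"
    and \<omega>: "\<omega> \<in> lag_forms_c n p q U" and \<eta>: "\<eta> \<in> lag_forms_c n p q U"
  shows "(\<lambda>x A B. a * \<omega> x A B + b * \<eta> x A B) \<in> lag_forms_c n p q U"
proof (rule lag_forms_cI[of _ _ _ _ _ "supp_in U \<omega> \<union> supp_in U \<eta>"])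
  show "(\<lambda>x A B. a * \<omega> x A B + b * \<eta> x A B) \<in> lag_forms n p q U"
    using lag_forms_combination[OF U] \<omega> \<eta> by (simp add: lag_forms_c_def)
  show "compact (supp_in U \<omega> \<union> supp_in U \<eta>)"
    using \<omega> \<eta> by (simp add: lag_forms_c_def compact_Un)
  show "supp_in U \<omega> \<union> supp_in U \<eta> \<subseteq> U"
    by (intro Un_least supp_in_subset)
  show "x \<in> supp_in U \<omega> \<union> supp_in U \<eta>"
    if x: "x \<in> U" and nz: "(\<lambda>A B. a * \<omega> x A B + b * \<eta> x A B) \<noteq> 0" for x
  proof -
    have "\<omega> x \<noteq> 0 \<or> \<eta> x \<noteq> 0"
      using nz by (auto simp: zero_fun_def)
    then show ?thesis
      using supp_inI[OF x, of \<omega>] supp_inI[OF x, of \<eta>] by blast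
  qed
qed

lemma lag_forms_zero: "0 \<in> lag_forms n p q U"
proof (rule lag_formsI)
  show "\<exists>V. openin (top_of_set U) V \<and> x \<in> V \<and> compat_on n L V 0" if "x \<in> U \<inter> stratum n L" for x L
    using that by (intro exI[of _ U]) (auto simp: compat_on_def)
qed (simp_all add: lval_of_type_def smooth_on_stratum_zero)

lemma subspace_lag_forms_c:
  assumes U: "openin (top_of_set (Rinf n)) U"
  shows "subspace (lag_forms_c n p q U)"
proof (rule subspaceI)
  show "0 \<in> lag_forms_c n p q U"
    by (rule lag_forms_cI[of _ _ _ _ _ "{}"]) (auto simp: lag_forms_zero)
  show "\<omega> + \<eta> \<in> lag_forms_c n p q U" if "\<omega> \<in> lag_forms_c n p q U" "\<eta> \<in> lag_forms_c n p q U" for \<omega> \<eta>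
    using lag_forms_c_combination[OF U that, of 1 1] by (simp add: plus_fun_def)
  show "c *\<^sub>R \<omega> \<in> lag_forms_c n p q U" if "\<omega> \<in> lag_forms_c n p q U" for c \<omega>
    using lag_forms_c_combination[OF U that that, of c 0] by (simp add: scaleR_fun_def)
qed

lemma test_functionsD:
  assumes "f \<in> test_functions n Y"
  shows "\<And>x. x \<notin> Y \<Longrightarrow> f x = 0"
    and "\<And>L. L \<subseteq> {1..n} \<Longrightarrow> smooth_on_stratum n L (Y \<inter> stratum n L) f"
    and "\<And>L x. L \<subseteq> {1..n} \<Longrightarrow> x \<in> Y \<inter> stratum n L \<Longrightarrow>
      \<exists>V. openin (top_of_set Y) V \<and> x \<in> V \<and> (\<forall>L'\<subseteq>L. \<forall>y\<in>V \<inter> stratum n L'.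
        to_stratum L y \<in> V \<inter> stratum n L \<longrightarrow> f y = f (to_stratum L y))"
    and "compact (supp_in Y f)"
proof -
  let ?\<omega> = "\<lambda>x. f x *\<^sub>R du {} {}"
  have coeff: "?\<omega> x {} {} = f x" for x
    by (simp add: scaleR_fun_def du_def)
  have \<omega>: "?\<omega> \<in> lag_forms n 0 0 Y" and K: "compact (supp_in Y ?\<omega>)"
    using assms by (simp_all add: test_functions_def lag_forms_c_def)
  note D = lag_formsD[OF \<omega>]
  show "f x = 0" if "x \<notin> Y" for x
    using fun_cong[OF fun_cong[OF D(1)[OF that]], of "{}" "{}"] unfolding coeff by simp
  show "smooth_on_stratum n L (Y \<inter> stratum n L) f" if "L \<subseteq> {1..n}" for L
    using D(3)[OF that, of "{}" "{}"] unfolding coeff .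
  have nz: "?\<omega> x \<noteq> 0 \<longleftrightarrow> f x \<noteq> 0" for x
    using coeff[of x] by auto
  show "compact (supp_in Y f)"
    using K unfolding supp_in_def nz .
  fix L x assume L: "L \<subseteq> {1..n}" and x: "x \<in> Y \<inter> stratum n L"
  obtain V where V: "openin (top_of_set Y) V" "x \<in> V" "compat_on n L V ?\<omega>"
    using D(4)[OF L x] by (elim exE conjE)
  have "f y = f (to_stratum L y)"
    if "L' \<subseteq> L" "y \<in> V \<inter> stratum n L'" "to_stratum L y \<in> V \<inter> stratum n L" for L' y
    using fun_cong[OF fun_cong[OF compat_onD[OF V(3) that]], of "{}" "{}"] unfolding coeff .
  then show "\<exists>V. openin (top_of_set Y) V \<and> x \<in> V \<and> (\<forall>L'\<subseteq>L. \<forall>y\<in>V \<inter> stratum n L'.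
        to_stratum L y \<in> V \<inter> stratum n L \<longrightarrow> f y = f (to_stratum L y))"
    by (intro exI[of _ V] conjI V(1,2) allI impI ballI)
qed

lemma stratum_Einf_iff:
  assumes "x \<in> stratum n L" "K \<subseteq> {1..n}"
  shows "x \<in> Einf n K \<longleftrightarrow> L \<inter> K \<noteq> {}"
proof -
  have "L \<inter> K = {i \<in> K. x i = \<infinity>}" "x \<in> Rinf n"
    using assms by (auto simp: stratum_def infs_def)
  then show ?thesis by (auto simp: Einf_def)
qed

lemma openin_Diff_Einf:
  assumes U: "openin (top_of_set (Rinf n)) U" and K: "K \<subseteq> {1..n}"
  shows "openin (top_of_set (Rinf n)) (U - Einf n K)"
proof -
  have "finite K" using K finite_subset by blast
  then have "closed (\<Union>i\<in>K. {x::point. x i = \<infinity>})"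
    by (intro closed_UN ballI closed_Collect_eq continuous_intros)
  then have "closedin (top_of_set (Rinf n)) (Rinf n \<inter> (\<Union>i\<in>K. {x. x i = \<infinity>}))"
    by (rule closedin_closed_Int)
  moreover have "Rinf n \<inter> (\<Union>i\<in>K. {x. x i = \<infinity>}) = Einf n K"
    by (auto simp: Einf_def)
  ultimately show ?thesis using openin_diff[OF U] by simp
qed

text \<open>The support of \<open>f\<close> is compact in the smaller set, hence closed, so \<open>f\<close> vanishes near \<open>Einf n K\<close>. On
  the strata that meet \<open>Einf n K\<close> the indices in \<open>A\<close> and \<open>B\<close> may be unavailable, but there the form is zero.\<close>

lemma coefficient_form:
  assumes f: "f \<in> test_functions n (U - Einf n K)" and U: "openin (top_of_set (Rinf n)) U"
    and K: "A \<subseteq> K" "B \<subseteq> K" "K \<subseteq> {1..n}" and card: "card A = q" "card B = r"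
  shows "(\<lambda>x. f x *\<^sub>R du A B) \<in> lag_forms_c n q r U"
proof -
  let ?Y = "U - Einf n K" and ?\<omega> = "\<lambda>x. f x *\<^sub>R du A B"
  note D = test_functionsD[OF f]
  have open_Y: "openin (top_of_set U) ?Y"
    by (rule openin_subset_trans[OF openin_Diff_Einf[OF U K(3)] Diff_subset openin_imp_subset[OF U]])
  have val: "?\<omega> x I J = (if I = A \<and> J = B then f x else 0)" for x I J
    by (simp add: scaleR_fun_def du_def)
  have f_stratum: "f x = 0" if "x \<in> U \<inter> stratum n L" "L \<inter> K \<noteq> {}" for x L
    using that D(1)[of x] stratum_Einf_iff[of x n L, OF _ K(3)] by simp
  have in_Y: "U \<inter> stratum n L = ?Y \<inter> stratum n L" if "L \<inter> K = {}" for L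
    using that stratum_Einf_iff[of _ n L, OF _ K(3)] by auto
  have supp: "x \<in> supp_in ?Y f" if "f x \<noteq> 0" for x
    using that D(1)[of x] supp_inI[of x ?Y f] by blast
  have closed_supp: "closed (supp_in ?Y f)"
    using D(4) by (rule compact_imp_closed)
  have "?\<omega> \<in> lag_forms n q r U"
  proof (rule lag_formsI)
    show "?\<omega> x = 0" if "x \<notin> U" for x
      using D(1)[of x] that by (simp add: scaleR_fun_def zero_fun_def)
    fix L assume L: "L \<subseteq> {1..n}"
    show "smooth_on_stratum n L (U \<inter> stratum n L) (\<lambda>x. ?\<omega> x I J)" for I J
    proof (cases "I = A \<and> J = B \<and> L \<inter> K = {}")
      case True
      then have "(\<lambda>x. ?\<omega> x I J) = f" using val by auto
      then show ?thesis using D(2)[OF L] in_Y True by simp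
    next
      case False
      show ?thesis
      proof (rule smooth_on_stratum_cong[OF U _ smooth_on_stratum_zero])
        show "0 = ?\<omega> x I J" if "x \<in> U \<inter> stratum n L" for x
          using f_stratum[OF that] False unfolding val by auto
      qed
    qed
    fix x assume x: "x \<in> U \<inter> stratum n L"
    show "lval_of_type ({1..n} - L) q r (?\<omega> x)"
      using f_stratum[OF x] K card unfolding lval_of_type_def val by auto
    show "\<exists>V. openin (top_of_set U) V \<and> x \<in> V \<and> compat_on n L V ?\<omega>"
    proof (cases "L \<inter> K = {}")
      case True
      then have "x \<in> ?Y \<inter> stratum n L" using in_Y x by blast
      from D(3)[OF L this] obtain V where V: "openin (top_of_set ?Y) V" "x \<in> V"
        and eq: "\<forall>L'\<subseteq>L. \<forall>y\<in>V \<inter> stratum n L'.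
          to_stratum L y \<in> V \<inter> stratum n L \<longrightarrow> f y = f (to_stratum L y)"
        by (elim exE conjE)
      have "compat_on n L V ?\<omega>"
        unfolding compat_on_def using eq by simp
      then show ?thesis
        using V(2) openin_trans[OF V(1) open_Y] by (intro exI[of _ V] conjI)
    next
      case False
      let ?V = "U - supp_in ?Y f"
      have "openin (top_of_set U) ?V"
        using closed_supp by (simp add: Diff_eq openin_open_Int open_Compl)
      moreover have "x \<notin> supp_in ?Y f"
      proof -
        have "x \<in> Einf n K"
          using x False stratum_Einf_iff[of x n L, OF _ K(3)] by simp
        then show ?thesis by (simp add: supp_in_def)
      qed
      moreover have "compat_on n L ?V ?\<omega>"
        unfolding compat_on_def
      proof (intro allI impI ballI)
        fix L' y assume "y \<in> ?V \<inter> stratum n L'" "to_stratum L y \<in> ?V \<inter> stratum n L"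
        then have "f y = 0" "f (to_stratum L y) = 0" using supp by auto
        then show "?\<omega> y = ?\<omega> (to_stratum L y)" by simp
      qed
      ultimately show ?thesis using x by (intro exI[of _ ?V]) auto
    qed
  qed
  moreover have "supp_in ?Y f \<subseteq> U" by (auto simp: supp_in_def)
  moreover have "x \<in> supp_in ?Y f" if "?\<omega> x \<noteq> 0" for x
    using that by (intro supp) auto
  ultimately show ?thesis
    using D(4) by (intro lag_forms_cI[of _ _ _ _ _ "supp_in ?Y f"])
qed

lemma subspace_test_functions:
  assumes Y: "openin (top_of_set (Rinf n)) Y"
  shows "subspace (test_functions n Y)"
proof (rule subspaceI)
  note S = subspace_lag_forms_c[OF Y, of 0 0]
  let ?\<omega> = "\<lambda>f (x::point). f x *\<^sub>R du {} {}"
  have "?\<omega> 0 = 0" by (simp add: fun_eq_iff)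
  then show "0 \<in> test_functions n Y"
    using subspace_0[OF S] by (simp add: test_functions_def)
  show "f + g \<in> test_functions n Y" if "f \<in> test_functions n Y" "g \<in> test_functions n Y" for f g
  proof -
    have "?\<omega> (f + g) = ?\<omega> f + ?\<omega> g" by (simp add: fun_eq_iff scaleR_add_left)
    then show ?thesis
      using that subspace_add[OF S, of "?\<omega> f" "?\<omega> g"] by (simp add: test_functions_def)
  qed
  show "c *\<^sub>R f \<in> test_functions n Y" if "f \<in> test_functions n Y" for c f
  proof -
    have "?\<omega> (c *\<^sub>R f) = c *\<^sub>R ?\<omega> f" by (simp add: fun_eq_iff scaleR_fun_def)
    then show ?thesis
      using that subspace_scale[OF S, of "?\<omega> f" c] by (simp add: test_functions_def)
  qed
qed

text \<open>Cutting off by zero outside \<open>Y\<close> does not change \<open>h\<close> on \<open>Rinf n\<close>, and the conditions on a Lagerberg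
  form concern only points of \<open>Rinf n\<close>.\<close>

lemma flat_algebra_test_function:
  assumes h: "h \<in> flat_algebra n" and Y: "openin (top_of_set (Rinf n)) Y"
    and K: "compact K" "K \<subseteq> Y" and supp: "\<And>x. x \<in> Rinf n \<Longrightarrow> h x \<noteq> 0 \<Longrightarrow> x \<in> K"
  shows "(\<lambda>x. if x \<in> Y then h x else 0) \<in> test_functions n Y"
proof -
  let ?f = "\<lambda>x. if x \<in> Y then h x else 0"
  let ?\<omega> = "\<lambda>x. ?f x *\<^sub>R du {} {}"
  have YR: "Y \<subseteq> Rinf n" using Y openin_imp_subset by blast
  have val: "?\<omega> x I J = (if I = {} \<and> J = {} then ?f x else 0)" for x I J
    by (simp add: scaleR_fun_def du_def)
  have f_eq: "?f x = h x" if "x \<in> Rinf n" for x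
    using supp[OF that] K(2) by auto
  have "?\<omega> \<in> lag_forms n 0 0 Y"
  proof (rule lag_formsI)
    show "?\<omega> x = 0" if "x \<notin> Y" for x
      using that by simp
    fix L assume L: "L \<subseteq> {1..n}"
    show "smooth_on_stratum n L (Y \<inter> stratum n L) (\<lambda>x. ?\<omega> x I J)" for I J
    proof (cases "I = {} \<and> J = {}")
      case True
      show ?thesis
      proof (rule smooth_on_stratum_cong[OF Y _ flat_algebra_smooth[OF h YR]])
        show "h x = ?\<omega> x I J" if "x \<in> Y \<inter> stratum n L" for x
          unfolding val using True that by simp
      qed
    next
      case False
      show ?thesis
      proof (rule smooth_on_stratum_cong[OF Y _ smooth_on_stratum_zero])
        show "0 = ?\<omega> x I J" for x
          unfolding val using False by auto
      qed
    qed
    fix x assume x: "x \<in> Y \<inter> stratum n L"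
    show "lval_of_type ({1..n} - L) 0 0 (?\<omega> x)"
      unfolding lval_of_type_def val by auto
    have "L = infs n x" using x by (simp add: stratum_def)
    from flat_algebra_locally_pullback[OF h this] obtain V
      where V: "open V" "x \<in> V" and eq: "\<forall>y\<in>V. h (to_stratum L y) = h y"
      by (elim exE conjE)
    have "compat_on n L (Y \<inter> V) ?\<omega>"
      unfolding compat_on_def
    proof (intro allI impI ballI)
      fix L' y assume y: "y \<in> Y \<inter> V \<inter> stratum n L'" "to_stratum L y \<in> Y \<inter> V \<inter> stratum n L"
      then have "h (to_stratum L y) = h y" using eq by simp
      then show "?\<omega> y = ?\<omega> (to_stratum L y)" using y by simp
    qed
    then show "\<exists>V. openin (top_of_set Y) V \<and> x \<in> V \<and> compat_on n L V ?\<omega>"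
      using V x by (intro exI[of _ "Y \<inter> V"] conjI openin_open_Int) auto
  qed
  moreover have "x \<in> K" if "?\<omega> x \<noteq> 0" for x
    using that YR by (intro supp) (auto split: if_splits)
  ultimately show ?thesis
    unfolding test_functions_def mem_Collect_eq using K by (intro lag_forms_cI[of _ _ _ _ _ K])
qed

section \<open>Bump functions and approximation by test functions\<close>

definition below :: "nat \<Rightarrow> real \<Rightarrow> point \<Rightarrow> real"
  where "below i b x = (if \<bar>x i\<bar> = \<infinity> then 0 else flat 0 (b - real_of_ereal (x i)))"

definition above :: "nat \<Rightarrow> real \<Rightarrow> point \<Rightarrow> real"
  where "above i a x = flat 0 (flat 0 1 + (-1) * below i (a + 1) x)"

lemma below_in_flat_algebra: "i \<in> {1..n} \<Longrightarrow> below i b \<in> flat_algebra n"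
  using flat_algebra.coord[of i n 0 b] by (simp add: below_def[abs_def])

lemma above_in_flat_algebra: "i \<in> {1..n} \<Longrightarrow> above i a \<in> flat_algebra n"
  unfolding above_def[abs_def] by (intro flat_algebra.intros below_in_flat_algebra)

lemma below_nonneg: "0 \<le> below i b x"
  by (simp add: below_def flat_nonneg)

lemma above_nonneg: "0 \<le> above i b x"
  by (simp add: above_def flat_nonneg)

lemma below_pos: "\<bar>x i\<bar> \<noteq> \<infinity> \<Longrightarrow> x i < ereal b \<Longrightarrow> 0 < below i b x"
  by (cases "x i") (auto simp: below_def intro: flat_pos)

lemma below_nonzero: "below i b x \<noteq> 0 \<Longrightarrow> x i < ereal b"
  by (cases "x i") (auto simp: below_def intro: ccontr)

text \<open>The constant \<open>flat 0 1\<close> is the value of \<open>below i (a + 1)\<close> at \<open>u\<^sub>i = a\<close>. As \<open>below i (a + 1)\<close> is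
  decreasing, it is smaller than this constant exactly beyond \<open>a\<close>, including at infinity.\<close>

lemma above_pos:
  assumes "ereal a < x i"
  shows "0 < above i a x"
proof -
  have "below i (a + 1) x < flat 0 1"
  proof (cases "x i")
    case (real r)
    show ?thesis
    proof (cases "a + 1 - r \<le> 0")
      case True
      then show ?thesis using real flat_pos[of 1 0] by (simp add: below_def)
    next
      case False
      then show ?thesis
        using real assms by (auto simp: below_def intro!: flat_0_strict_mono)
    qed
  qed (use assms flat_pos[of 1 0] in \<open>auto simp: below_def\<close>)
  then show ?thesis
    unfolding above_def by (intro flat_pos) simp
qed

lemma above_nonzero:
  assumes "above i a x \<noteq> 0" "x i \<noteq> -\<infinity>"
  shows "ereal a < x i"
proof (rule ccontr)
  assume "\<not> ereal a < x i"
  then obtain r where r: "x i = ereal r" "r \<le> a"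
    using assms(2) by (cases "x i") auto
  have "flat 0 1 \<le> flat 0 (a + 1 - r)"
    using flat_0_strict_mono[of 1 "a + 1 - r"] r(2) by (cases "r = a") auto
  then have "above i a x = 0"
    by (simp add: above_def below_def r(1))
  with assms(1) show False by simp
qed

text \<open>At a finite point the bump is a product of two steps supported in a compact interval. At infinity a
  single upward step is enough, as \<open>{a..\<infinity>}\<close> is compact.\<close>

lemma coordinate_bump:
  assumes i: "i \<in> {1..n}" and S: "open S" "s \<in> S" "-\<infinity> \<notin> S"
  shows "\<exists>h\<in>flat_algebra n. \<exists>C. compact C \<and> C \<subseteq> S \<and> (\<forall>x. 0 \<le> h x) \<and>
    (\<forall>x. x i = s \<longrightarrow> 0 < h x) \<and> (\<forall>x. x i \<noteq> -\<infinity> \<longrightarrow> h x \<noteq> 0 \<longrightarrow> x i \<in> C)"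
proof (cases "s = \<infinity>")
  case True
  then obtain a where a: "{ereal a<..} \<subseteq> S"
    using open_PInfty[of S] S by auto
  have "compact {ereal (a + 1)..}"
    by (simp add: compact_eq_closed)
  moreover have "{ereal (a + 1)..} \<subseteq> S"
  proof
    fix c assume "c \<in> {ereal (a + 1)..}"
    then have "ereal a < c" using less_le_trans[of "ereal a" "ereal (a + 1)" c] by simp
    then show "c \<in> S" using a by blast
  qed
  moreover have "0 < above i (a + 1) x" if "x i = s" for x
    using that True by (intro above_pos) simp
  moreover have "x i \<in> {ereal (a + 1)..}" if "x i \<noteq> -\<infinity>" "above i (a + 1) x \<noteq> 0" for x
    using above_nonzero[OF that(2,1)] by simp
  ultimately show ?thesis
    by (intro bexI[OF _ above_in_flat_algebra[OF i, of "a + 1"]] exI[of _ "{ereal (a + 1)..}"]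
        conjI allI impI above_nonneg)
next
  case False
  then have fin: "\<bar>s\<bar> \<noteq> \<infinity>" using S by (cases s) auto
  obtain a' b' where ab': "a' < s" "s < b'" "{a'<..<b'} \<subseteq> S"
    using ereal_open_cont_interval2[OF S(1,2) fin] by blast
  obtain a b where ab: "a' < ereal a" "ereal a < s" "s < ereal b" "ereal b < b'"
    using ereal_dense2[OF ab'(1)] ereal_dense2[OF ab'(2)] by blast
  let ?h = "\<lambda>x. above i a x * below i b x"
  have h: "?h \<in> flat_algebra n"
    by (intro flat_algebra.intros above_in_flat_algebra below_in_flat_algebra i)
  have "compact {ereal a..ereal b}"
    by (simp add: compact_eq_closed)
  moreover have "{ereal a..ereal b} \<subseteq> S"
  proof
    fix c assume "c \<in> {ereal a..ereal b}"
    then have "a' < c" "c < b'"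
      using less_le_trans[OF ab(1), of c] le_less_trans[OF _ ab(4), of c] by auto
    then show "c \<in> S" using ab'(3) by auto
  qed
  moreover have "0 \<le> ?h x" for x
    by (simp add: above_nonneg below_nonneg)
  moreover have "0 < ?h x" if "x i = s" for x
    using that above_pos[of a x i] below_pos[of x i b] ab fin by simp
  moreover have "x i \<in> {ereal a..ereal b}" if "x i \<noteq> -\<infinity>" "?h x \<noteq> 0" for x
    using that above_nonzero[of i a x] below_nonzero[of i b x] by auto
  ultimately show ?thesis
    by (intro bexI[OF _ h] exI[of _ "{ereal a..ereal b}"] conjI allI impI)
qed

text \<open>The point has a neighbourhood inside \<open>Y\<close> that is a product of open sets, and a product of
  coordinate bumps is supported in a product of compact sets.\<close>

lemma bump_at_point:
  assumes Y: "openin (top_of_set (Rinf n)) Y" and x: "x \<in> Y"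
  shows "\<exists>h\<in>flat_algebra n. \<exists>C. compact C \<and> C \<subseteq> Y \<and> (\<forall>y. 0 \<le> h y) \<and> 0 < h x \<and>
    (\<forall>y\<in>Rinf n. h y \<noteq> 0 \<longrightarrow> y \<in> C)"
proof -
  have "openin (product_topology (\<lambda>_. top_of_set {-\<infinity><..}) {1..n}) Y"
    using Y by (simp add: top_of_set_Rinf)
  from product_topology_open_contains_basis[OF this x] obtain X where
    X: "x \<in> PiE {1..n} X" "\<forall>i. openin (top_of_set {-\<infinity>::ereal<..}) (X i)" "PiE {1..n} X \<subseteq> Y"
    by (elim exE conjE)
  have openX: "open (X i)" and XM: "-\<infinity> \<notin> X i" for i
    using X(2)[rule_format, of i] openin_open_eq[of "{-\<infinity>::ereal<..}" "X i"] by auto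
  have "\<forall>i\<in>{1..n}. \<exists>h. h \<in> flat_algebra n \<and> (\<exists>C. compact C \<and> C \<subseteq> X i \<and> (\<forall>y. 0 \<le> h y) \<and>
    (\<forall>y. y i = x i \<longrightarrow> 0 < h y) \<and> (\<forall>y. y i \<noteq> -\<infinity> \<longrightarrow> h y \<noteq> 0 \<longrightarrow> y i \<in> C))"
    using coordinate_bump[OF _ openX _ XM, of _ n] X(1) unfolding Bex_def by (auto simp: PiE_iff)
  from bchoice[OF this] obtain h where h: "\<forall>i\<in>{1..n}. h i \<in> flat_algebra n \<and>
    (\<exists>C. compact C \<and> C \<subseteq> X i \<and> (\<forall>y. 0 \<le> h i y) \<and>
    (\<forall>y. y i = x i \<longrightarrow> 0 < h i y) \<and> (\<forall>y. y i \<noteq> -\<infinity> \<longrightarrow> h i y \<noteq> 0 \<longrightarrow> y i \<in> C))" ..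
  then have "\<forall>i\<in>{1..n}. \<exists>C. compact C \<and> C \<subseteq> X i \<and> (\<forall>y. 0 \<le> h i y) \<and>
    (\<forall>y. y i = x i \<longrightarrow> 0 < h i y) \<and> (\<forall>y. y i \<noteq> -\<infinity> \<longrightarrow> h i y \<noteq> 0 \<longrightarrow> y i \<in> C)"
    by simp
  from bchoice[OF this] obtain C where C: "\<forall>i\<in>{1..n}. compact (C i) \<and> C i \<subseteq> X i \<and> (\<forall>y. 0 \<le> h i y) \<and>
    (\<forall>y. y i = x i \<longrightarrow> 0 < h i y) \<and> (\<forall>y. y i \<noteq> -\<infinity> \<longrightarrow> h i y \<noteq> 0 \<longrightarrow> y i \<in> C i)" ..
  let ?h = "\<lambda>y. \<Prod>i\<in>{1..n}. h i y"
  have "?h \<in> flat_algebra n"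
    using h by (intro flat_algebra_prod) auto
  moreover have "compact (PiE {1..n} C)"
  proof -
    have "C i \<subseteq> {-\<infinity><..}" if "i \<in> {1..n}" for i
    proof
      fix c assume "c \<in> C i"
      then have "c \<in> X i" using C that by blast
      then have "c \<noteq> -\<infinity>" using XM[of i] by auto
      then show "c \<in> {-\<infinity><..}" by (simp add: less_le)
    qed
    then have "compactin (product_topology (\<lambda>_. top_of_set {-\<infinity><..}) {1..n}) (PiE {1..n} C)"
      using C unfolding compactin_PiE by (auto simp: compactin_subtopology)
    then show ?thesis
      unfolding top_of_set_Rinf[symmetric] by (simp add: compactin_subtopology)
  qed
  moreover have "PiE {1..n} C \<subseteq> Y"
  proof -
    have "PiE {1..n} C \<subseteq> PiE {1..n} X" using C by (intro PiE_mono) auto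
    then show ?thesis using X(3) by blast
  qed
  moreover have "0 \<le> ?h y" for y
    using C by (intro prod_nonneg) auto
  moreover have "0 < ?h x"
    using C by (intro prod_pos) auto
  moreover have "y \<in> PiE {1..n} C" if y: "y \<in> Rinf n" and nz: "?h y \<noteq> 0" for y
  proof -
    have "y i \<in> C i" if i: "i \<in> {1..n}" for i
    proof -
      have "h i y \<noteq> 0" using nz i by auto
      moreover have "y i \<noteq> -\<infinity>" using y i by (auto simp: Rinf_def PiE_iff)
      ultimately show ?thesis using C i by blast
    qed
    then show ?thesis using y by (auto simp: Rinf_def PiE_iff)
  qed
  ultimately show ?thesis
    by (intro bexI[of _ ?h] exI[of _ "PiE {1..n} C"] conjI allI ballI impI)
qed

text \<open>Finitely many bumps have a sum that is positive on \<open>K\<close>; dividing by its minimum there makes it at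
  least one.\<close>

lemma bump_on_compact:
  assumes Y: "openin (top_of_set (Rinf n)) Y" and K: "compact K" "K \<subseteq> Y"
  shows "\<exists>h\<in>flat_algebra n. \<exists>C. compact C \<and> C \<subseteq> Y \<and> (\<forall>y. 0 \<le> h y) \<and> (\<forall>x\<in>K. 1 \<le> h x) \<and>
    (\<forall>y\<in>Rinf n. h y \<noteq> 0 \<longrightarrow> y \<in> C)"
proof -
  have YR: "Y \<subseteq> Rinf n" using Y openin_imp_subset by blast
  have "\<forall>x\<in>Y. \<exists>h. h \<in> flat_algebra n \<and> (\<exists>C. compact C \<and> C \<subseteq> Y \<and> (\<forall>y. 0 \<le> h y) \<and> 0 < h x \<and>
    (\<forall>y\<in>Rinf n. h y \<noteq> 0 \<longrightarrow> y \<in> C))"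
    using bump_at_point[OF Y] unfolding Bex_def by simp
  from bchoice[OF this] obtain h where h: "\<forall>x\<in>Y. h x \<in> flat_algebra n \<and>
    (\<exists>C. compact C \<and> C \<subseteq> Y \<and> (\<forall>y. 0 \<le> h x y) \<and> 0 < h x x \<and> (\<forall>y\<in>Rinf n. h x y \<noteq> 0 \<longrightarrow> y \<in> C))" ..
  then have "\<forall>x\<in>Y. \<exists>C. compact C \<and> C \<subseteq> Y \<and> (\<forall>y. 0 \<le> h x y) \<and> 0 < h x x \<and>
    (\<forall>y\<in>Rinf n. h x y \<noteq> 0 \<longrightarrow> y \<in> C)"
    by simp
  from bchoice[OF this] obtain C where C: "\<forall>x\<in>Y. compact (C x) \<and> C x \<subseteq> Y \<and> (\<forall>y. 0 \<le> h x y) \<and> 0 < h x x \<and>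
    (\<forall>y\<in>Rinf n. h x y \<noteq> 0 \<longrightarrow> y \<in> C x)" ..
  have "\<forall>x\<in>Y. \<exists>V. open V \<and> V \<inter> Rinf n = {y \<in> Rinf n. 0 < h x y}"
  proof
    fix x assume x: "x \<in> Y"
    have "continuous_on (Rinf n) (h x)"
      using h x by (intro flat_algebra_continuous) auto
    then have "openin (top_of_set (Rinf n)) (Rinf n \<inter> h x -` {0<..})"
      by (rule continuous_openin_preimage_gen) simp
    then obtain V where V: "open V" "Rinf n \<inter> h x -` {0<..} = Rinf n \<inter> V"
      unfolding openin_open by blast
    have "V \<inter> Rinf n = {y \<in> Rinf n. 0 < h x y}"
      using V(2) by blast
    with V(1) show "\<exists>V. open V \<and> V \<inter> Rinf n = {y \<in> Rinf n. 0 < h x y}" by blast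
  qed
  from bchoice[OF this] obtain V where V: "\<forall>x\<in>Y. open (V x) \<and> V x \<inter> Rinf n = {y \<in> Rinf n. 0 < h x y}" ..
  have "K \<subseteq> (\<Union>x\<in>K. V x)"
  proof
    fix x assume x: "x \<in> K"
    then have "x \<in> {y \<in> Rinf n. 0 < h x y}" using C K(2) YR by auto
    then have "x \<in> V x" using V K(2) x by blast
    then show "x \<in> (\<Union>x\<in>K. V x)" using x by blast
  qed
  moreover have "\<And>x. x \<in> K \<Longrightarrow> open (V x)" using V K(2) by blast
  ultimately obtain F where F: "F \<subseteq> K" "finite F" "K \<subseteq> (\<Union>x\<in>F. V x)"
    using compactE_image[OF K(1), of K V] by blast
  let ?s = "\<lambda>y. \<Sum>x\<in>F. h x y"
  have FY: "F \<subseteq> Y" using F(1) K(2) by blast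
  have s_alg: "?s \<in> flat_algebra n"
    using h FY by (intro flat_algebra_sum F(2)) auto
  have s_nonneg: "0 \<le> ?s y" for y
    using C FY by (intro sum_nonneg) auto
  have s_pos: "0 < ?s y" if y: "y \<in> K" for y
  proof -
    obtain x where x: "x \<in> F" "y \<in> V x" using F(3) y by blast
    then have "0 < h x y" using V FY y K(2) YR by blast
    moreover have "0 \<le> h z y" if "z \<in> F" for z using C FY that by blast
    ultimately show ?thesis by (intro sum_pos2[OF F(2) x(1)])
  qed
  obtain d where d: "0 < d" "\<And>y. y \<in> K \<Longrightarrow> d \<le> ?s y"
  proof (cases "K = {}")
    case True
    then show thesis using that[of 1] by simp
  next
    case False
    have "continuous_on K ?s"
      using continuous_on_subset[OF flat_algebra_continuous[OF s_alg]] K(2) YR by blast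
    then obtain x where "x \<in> K" "\<And>y. y \<in> K \<Longrightarrow> ?s x \<le> ?s y"
      using continuous_attains_inf[OF K(1) False] by metis
    then show thesis using that[of "?s x"] s_pos by blast
  qed
  let ?h = "\<lambda>y. inverse d * ?s y"
  have "?h \<in> flat_algebra n"
    by (intro flat_algebra.mult flat_algebra.const s_alg)
  moreover have "compact (\<Union>x\<in>F. C x)"
    using C FY by (intro compact_UN F(2)) auto
  moreover have "(\<Union>x\<in>F. C x) \<subseteq> Y" using C FY by blast
  moreover have "0 \<le> ?h y" for y
    using s_nonneg[of y] d(1) by (intro mult_nonneg_nonneg) auto
  moreover have "1 \<le> ?h y" if "y \<in> K" for y
    using d(2)[OF that] d(1) by (simp add: field_simps)
  moreover have "y \<in> (\<Union>x\<in>F. C x)" if y: "y \<in> Rinf n" and nz: "?h y \<noteq> 0" for y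
  proof -
    have "\<exists>x\<in>F. h x y \<noteq> 0"
      by (rule ccontr) (use nz in simp)
    then obtain x where "x \<in> F" "h x y \<noteq> 0" by blast
    then show ?thesis using C FY y by blast
  qed
  ultimately show ?thesis
    by (intro bexI[of _ ?h] exI[of _ "\<Union>x\<in>F. C x"] conjI allI ballI impI)
qed

lemma test_function_bump:
  assumes Y: "openin (top_of_set (Rinf n)) Y" and K: "compact K" "K \<subseteq> Y"
  shows "\<exists>\<kappa>\<in>test_functions n Y. (\<forall>y. 0 \<le> \<kappa> y) \<and> (\<forall>x\<in>K. 1 \<le> \<kappa> x)"
proof -
  obtain h C where h: "h \<in> flat_algebra n" "compact C" "C \<subseteq> Y" "\<forall>y. 0 \<le> h y" "\<forall>x\<in>K. 1 \<le> h x"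
    "\<forall>y\<in>Rinf n. h y \<noteq> 0 \<longrightarrow> y \<in> C"
    using bump_on_compact[OF assms] by (elim bexE exE conjE)
  have "(\<lambda>x. if x \<in> Y then h x else 0) \<in> test_functions n Y"
    using h(6) by (intro flat_algebra_test_function[OF h(1) Y h(2,3)]) simp
  then show ?thesis
    using h(4,5) K(2) by (intro bexI[of _ "\<lambda>x. if x \<in> Y then h x else 0"]) auto
qed

lemma flat_algebra_separates:
  assumes "x \<in> Rinf n" "y \<in> Rinf n" "x \<noteq> y"
  shows "\<exists>f\<in>flat_algebra n. f x \<noteq> f y"
proof -
  have sep: "\<exists>f\<in>flat_algebra n. f x \<noteq> f y"
    if i: "i \<in> {1..n}" and less: "x i < y i" and x: "x i \<noteq> -\<infinity>" for x y :: point and i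
  proof -
    obtain a where a: "x i < ereal a" "ereal a < y i"
      using ereal_dense2[OF less] by blast
    have "above i a x = 0"
      using above_nonzero[of i a x] x less_asym[OF a(1)] by blast
    moreover have "0 < above i a y"
      using a(2) by (rule above_pos)
    ultimately show ?thesis by (intro bexI[OF _ above_in_flat_algebra[OF i, of a]]) simp
  qed
  obtain i where i: "i \<in> {1..n}" "x i \<noteq> y i"
    using PiE_ext[of x "{1..n}" _ y] assms unfolding Rinf_def by blast
  then have "x i \<noteq> -\<infinity>" "y i \<noteq> -\<infinity>"
    using assms by (auto simp: Rinf_def PiE_iff)
  then show ?thesis
    using sep[OF i(1), of x y] sep[OF i(1), of y x] i(2) by (metis less_linear)
qed

text \<open>Stone-Weierstrass is applied to the quotient of \<open>f\<close> by a bump \<open>h\<close> with \<open>h \<ge> 1\<close> on the support of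
  \<open>f\<close>, on the compact support of \<open>h\<close>. Multiplying the approximating functions by \<open>h\<close> gives them compact support
  and turns the uniform error into a multiple of \<open>h\<close>, so that \<open>h\<close> is the common majorant.\<close>

lemma Cc_order_approx:
  assumes Y: "openin (top_of_set (Rinf n)) Y" and f: "f \<in> Cc Y"
  shows "\<exists>g. order_approx (test_functions n Y) f g"
proof -
  have YR: "Y \<subseteq> Rinf n" using Y openin_imp_subset by blast
  obtain h C where h: "h \<in> flat_algebra n" "compact C" "C \<subseteq> Y" "\<forall>y. 0 \<le> h y"
    "\<forall>x\<in>supp_in Y f. 1 \<le> h x" "\<forall>y\<in>Rinf n. h y \<noteq> 0 \<longrightarrow> y \<in> C"
    using bump_on_compact[OF Y CcD(3)[OF f] supp_in_subset] by (elim bexE exE conjE)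
  \<comment> \<open>The maximum equals \<open>h\<close> on the support of \<open>f\<close> and keeps the quotient continuous elsewhere.\<close>
  let ?F = "\<lambda>x. f x / max 1 (h x)"
  have f_eq: "f x = ?F x * h x" if "x \<in> Y" for x
  proof (cases "f x = 0")
    case False
    have "1 \<le> h x" by (rule bspec[OF h(5) supp_inI[where f = f, OF that False]])
    then show ?thesis by (simp add: max_absorb2)
  qed simp
  have CR: "C \<subseteq> Rinf n" using h(3) YR by (rule order_trans)
  have F_cont: "continuous_on C ?F"
  proof (intro continuous_on_divide continuous_on_max continuous_on_const)
    show "continuous_on C f" by (rule continuous_on_subset[OF CcD(1)[OF f] h(3)])
    show "continuous_on C h" by (rule continuous_on_subset[OF flat_algebra_continuous[OF h(1)] CR])
    show "\<forall>x\<in>C. max 1 (h x) \<noteq> 0"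
      by (auto simp: max_def)
  qed
  interpret function_ring_on "flat_algebra n" C
  proof
    show "continuous_on C g" if "g \<in> flat_algebra n" for g
      by (rule continuous_on_subset[OF flat_algebra_continuous[OF that] CR])
    show "\<exists>g\<in>flat_algebra n. g x \<noteq> g y" if "x \<in> C" "y \<in> C" "x \<noteq> y" for x y
      using that CR by (intro flat_algebra_separates) auto
  qed (auto intro: h(2) flat_algebra.intros)
  have "\<exists>g. g \<in> flat_algebra n \<and> (\<forall>x\<in>C. \<bar>?F x - g x\<bar> < inverse (real (Suc k)))" for k
    using Stone_Weierstrass_basic[OF F_cont, of "inverse (real (Suc k))"]
    unfolding Bex_def by simp
  then have "\<forall>k. \<exists>g. g \<in> flat_algebra n \<and> (\<forall>x\<in>C. \<bar>?F x - g x\<bar> < inverse (real (Suc k)))" ..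
  from choice[OF this] obtain g where
    g: "\<forall>k. g k \<in> flat_algebra n \<and> (\<forall>x\<in>C. \<bar>?F x - g k x\<bar> < inverse (real (Suc k)))" ..
  have test: "(\<lambda>x. if x \<in> Y then u x * h x else 0) \<in> test_functions n Y" if "u \<in> flat_algebra n" for u
    using h(6) by (intro flat_algebra_test_function[OF _ Y h(2,3)] flat_algebra.mult that h(1)) simp
  have "order_approx (test_functions n Y) f (\<lambda>k x. if x \<in> Y then g k x * h x else 0)"
  proof (rule order_approxI)
    show "(\<lambda>x. if x \<in> Y then 1 * h x else 0) \<in> test_functions n Y"
      by (intro test flat_algebra.const)
    show "0 \<le> (if x \<in> Y then 1 * h x else 0)" for x
      using h(4) by simp
    show "(\<lambda>x. if x \<in> Y then g k x * h x else 0) \<in> test_functions n Y" for k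
      using g by (intro test) simp
    show "\<bar>f x - (if x \<in> Y then g k x * h x else 0)\<bar>
        \<le> inverse (real (Suc k)) * (if x \<in> Y then 1 * h x else 0)" for k x
    proof (cases "x \<in> Y")
      case True
      have "f x - g k x * h x = (?F x - g k x) * h x"
        by (simp only: left_diff_distrib f_eq[OF True, symmetric])
      then have "\<bar>f x - g k x * h x\<bar> = \<bar>?F x - g k x\<bar> * h x"
        using h(4) by (simp add: abs_mult)
      also have "\<dots> \<le> inverse (real (Suc k)) * h x"
      proof (cases "h x = 0")
        case False
        then have "x \<in> C" using h(6) True YR by blast
        then show ?thesis using g h(4) by (intro mult_right_mono) (auto intro: less_imp_le)
      qed simp
      finally show ?thesis using True by simp
    next
      case False
      then show ?thesis using CcD(2)[OF f] by simp
    qed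
  qed
  then show ?thesis by blast
qed

section \<open>Radon measures from dominated functionals\<close>

text \<open>A function supported in \<open>K\<close> is bounded by its supremum times a test function that is at least one
  on \<open>K\<close>, and this multiple dominates the value of the functional.\<close>

lemma extension_radon_measure:
  assumes Y: "openin (top_of_set (Rinf n)) Y" and E: "E = test_functions n Y"
    and l: "linear_functional_on E l" and N: "linear_functional_on E N" and dom: "dominated_on E l N"
  shows "extension E l \<in> radon_measures Y"
proof (rule radon_measureI)
  have sub: "subspace E" unfolding E by (rule subspace_test_functions[OF Y])
  have approx: "\<exists>g. order_approx E f g" if "f \<in> Cc Y" for f
    unfolding E by (rule Cc_order_approx[OF Y that])
  show "linear_functional_on (Cc Y) (extension E l)"
    by (rule extension_linear[OF sub l N dom approx])
  fix K assume K: "compact K" "K \<subseteq> Y"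
  obtain \<kappa> where \<kappa>: "\<kappa> \<in> E" "\<forall>y. 0 \<le> \<kappa> y" "\<forall>x\<in>K. 1 \<le> \<kappa> x"
    using test_function_bump[OF Y K] unfolding E by (elim bexE conjE)
  have "\<bar>extension E l f\<bar> \<le> N \<kappa> * Sup (insert 0 ((\<lambda>x. \<bar>f x\<bar>) ` K))"
    if f: "f \<in> Cc Y" and supp: "supp_in Y f \<subseteq> K" for f
  proof -
    let ?s = "Sup (insert 0 ((\<lambda>x. \<bar>f x\<bar>) ` K))"
    have "continuous_on K (\<lambda>x. \<bar>f x\<bar>)"
      by (intro continuous_intros continuous_on_subset[OF CcD(1)[OF f] K(2)])
    then have "bdd_above ((\<lambda>x. \<bar>f x\<bar>) ` K)"
      using K(1) by (intro bounded_imp_bdd_above compact_imp_bounded compact_continuous_image)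
    then have bdd: "bdd_above (insert 0 ((\<lambda>x. \<bar>f x\<bar>) ` K))" by simp
    have s0: "0 \<le> ?s" by (rule cSup_upper[OF _ bdd]) simp
    have le: "\<bar>f x\<bar> \<le> (?s *\<^sub>R \<kappa>) x" for x
    proof (cases "f x = 0")
      case True
      then show ?thesis using s0 \<kappa>(2) by (simp add: scaleR_fun_def)
    next
      case False
      then have "x \<in> Y" using CcD(2)[OF f, of x] by blast
      then have x: "x \<in> K" using supp_inI[of x Y f] False supp by blast
      then have "\<bar>f x\<bar> \<le> ?s" by (intro cSup_upper[OF _ bdd]) simp
      also have "?s * 1 \<le> ?s * \<kappa> x"
        using \<kappa>(3) x s0 by (intro mult_left_mono) auto
      finally show ?thesis by (simp add: scaleR_fun_def)
    qed
    obtain g where "order_approx E f g" using approx[OF f] ..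
    then have "\<bar>extension E l f\<bar> \<le> N (?s *\<^sub>R \<kappa>)"
      by (rule extension_abs_le[OF sub l N dom _ subspace_scale[OF sub \<kappa>(1)] le])
    also have "\<dots> = N \<kappa> * ?s"
      by (simp only: linear_functional_on_scale[OF N \<kappa>(1)] mult.commute)
    finally show ?thesis .
  qed
  then show "\<exists>c. \<forall>f\<in>Cc Y. supp_in Y f \<subseteq> K \<longrightarrow>
      \<bar>extension E l f\<bar> \<le> c * Sup (insert 0 ((\<lambda>x. \<bar>f x\<bar>) ` K))"
    by (intro exI[of _ "N \<kappa>"] ballI impI)
qed

text \<open>For \<open>f \<ge> 0\<close> the supremum belonging to the negative part of \<open>f\<close> runs over the zero function only.\<close>

lemma total_variation_le:
  fixes Y :: "'a::t2_space set"
  assumes lin: "linear_functional_on (Cc Y) \<mu>" and f: "f \<in> Cc Y" "\<And>x. 0 \<le> f x" and c: "0 \<le> c"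
    and le: "\<And>h. h \<in> Cc Y \<Longrightarrow> (\<And>x. \<bar>h x\<bar> \<le> f x) \<Longrightarrow> c * \<mu> h \<le> Q"
  shows "c * total_variation Y \<mu> f \<le> Q"
proof -
  have zero: "0 \<in> Cc Y" by (rule subspace_0[OF subspace_Cc])
  have \<mu>0: "\<mu> 0 = 0" by (rule linear_functional_on_zero[OF subspace_Cc lin])
  let ?G = "{g \<in> Cc Y. \<forall>x. \<bar>g x\<bar> \<le> f x}"
  have G0: "0 \<in> ?G" using zero f(2) by simp
  have "{g \<in> Cc Y. \<forall>x. \<bar>g x\<bar> \<le> max (- f x) 0} = {0}"
    using zero f(2) by (auto simp: max_def fun_eq_iff)
  moreover have "{g \<in> Cc Y. \<forall>x. \<bar>g x\<bar> \<le> max (f x) 0} = ?G"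
    using f(2) by (simp add: max_absorb1)
  ultimately have tv: "total_variation Y \<mu> f = (SUP g\<in>?G. \<mu> g)"
    by (simp add: total_variation_def \<mu>0)
  show ?thesis
  proof (cases "c = 0")
    case True
    then show ?thesis using le[OF zero] f(2) by simp
  next
    case False
    then have c: "0 < c" using c by simp
    have "(SUP g\<in>?G. \<mu> g) \<le> Q / c"
    proof (rule cSUP_least)
      show "?G \<noteq> {}" using G0 by blast
      show "\<mu> g \<le> Q / c" if "g \<in> ?G" for g
        using le[of g] that c by (simp add: field_simps)
    qed
    then show ?thesis using c by (simp add: tv field_simps)
  qed
qed

section \<open>Positivity of the co-coefficients\<close>

text \<open>Only the term \<open>I = A\<close>, \<open>J = {}\<close> of the double sum survives, because \<open>\<alpha>\<close> has no \<open>d''\<close> factors and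
  \<open>J(\<alpha>)\<close> no \<open>d'\<close> factors; all signs of that term are \<open>1\<close>.\<close>

lemma wedge_Jval:
  assumes \<alpha>: "lval_of_type S q 0 \<alpha>" and S: "finite S"
  shows "wedge \<alpha> (Jval \<alpha>) = (\<lambda>A B. \<alpha> A {} * \<alpha> B {})"
proof (intro ext)
  fix A B
  have nz: "I \<subseteq> S" "J = {}" if "\<alpha> I J \<noteq> 0" for I J
  proof -
    have "I \<subseteq> S" "J \<subseteq> S" "card J = 0"
      using \<alpha> that unfolding lval_of_type_def by auto
    then show "I \<subseteq> S" "J = {}" using finite_subset[OF _ S, of J] by auto
  qed
  let ?t = "\<lambda>I J. (-1) ^ (card J * card (A - I)) * shuffle_sign I (A - I) * shuffle_sign J (B - J)
       * \<alpha> I J * Jval \<alpha> (A - I) (B - J)"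
  have t0: "?t I J = 0" if "I \<subseteq> A" "\<not> (I = A \<and> J = {})" for I J
  proof (cases "J = {}")
    case True
    then have "A - I \<noteq> {}" using that by blast
    then have "\<alpha> (B - J) (A - I) = 0" using nz(2) by blast
    then show ?thesis by (simp add: Jval_def)
  next
    case False
    then have "\<alpha> I J = 0" using nz(2) by blast
    then show ?thesis by simp
  qed
  have tA: "?t A {} = \<alpha> A {} * \<alpha> B {}"
    by (simp add: shuffle_sign_def Jval_def)
  show "wedge \<alpha> (Jval \<alpha>) A B = \<alpha> A {} * \<alpha> B {}"
  proof (cases "finite A \<and> finite B")
    case True
    have "wedge \<alpha> (Jval \<alpha>) A B = (\<Sum>I\<in>Pow A. \<Sum>J\<in>Pow B. ?t I J)"
      by (simp only: wedge_def)
    also have "\<dots> = (\<Sum>I\<in>{A}. \<Sum>J\<in>Pow B. ?t I J)"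
      using True t0 by (intro sum.mono_neutral_right ballI sum.neutral) auto
    also have "\<dots> = (\<Sum>J\<in>Pow B. ?t A J)" by simp
    also have "\<dots> = (\<Sum>J\<in>{{}}. ?t A J)"
    proof (rule sum.mono_neutral_right)
      show "\<forall>J\<in>Pow B - {{}}. ?t A J = 0" using t0[of A] by blast
    qed (use True in auto)
    also have "\<dots> = ?t A {}" by simp
    finally show ?thesis using tA by simp
  next
    case False
    then have "\<not> A \<subseteq> S \<or> \<not> B \<subseteq> S" using S finite_subset by blast
    then have "\<alpha> A {} * \<alpha> B {} = 0" using nz(1)[of A "{}"] nz(1)[of B "{}"] by auto
    moreover have "wedge \<alpha> (Jval \<alpha>) A B = 0"
      using False by (auto simp: wedge_def finite_Pow_iff)
    ultimately show ?thesis by simp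
  qed
qed

abbreviation coefficient_term :: "nat \<Rightarrow> nat set \<Rightarrow> nat set \<Rightarrow> (point \<Rightarrow> real) \<Rightarrow> lform"
  where "coefficient_term q I J f \<equiv> (\<lambda>x. ((-1) ^ (q * (q - 1) div 2) * f x) *\<^sub>R du I J)"

lemma coefficient_term_linear:
  "coefficient_term q I J (f + g) = coefficient_term q I J f + coefficient_term q I J g"
  "coefficient_term q I J (c *\<^sub>R f) = c *\<^sub>R coefficient_term q I J f"
  by (simp_all add: fun_eq_iff scaleR_fun_def algebra_simps)

locale positive_lagerberg_current =
  fixes n p q :: nat and U :: "point set" and T :: "lform \<Rightarrow> real"
  assumes q_eq: "q = n - p"
    and U_open: "openin (top_of_set (Rinf n)) U"
    and T_current: "T \<in> currents n p p U" and T_positive: "positive_current n p U T"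
begin

abbreviation Y :: "nat set \<Rightarrow> nat set \<Rightarrow> point set"
  where "Y I J \<equiv> U - Einf n (I \<union> J)"

abbreviation test :: "nat set \<Rightarrow> nat set \<Rightarrow> (point \<Rightarrow> real) set"
  where "test I J \<equiv> test_functions n (Y I J)"

definition index_set :: "nat set \<Rightarrow> bool"
  where "index_set I \<longleftrightarrow> I \<subseteq> {1..n} \<and> card I = q"

lemma Y_open: "index_set I \<Longrightarrow> index_set J \<Longrightarrow> openin (top_of_set (Rinf n)) (Y I J)"
  by (intro openin_Diff_Einf U_open) (simp add: index_set_def)

lemma T_linear: "linear_functional_on (lag_forms_c n q q U) T"
  using T_current q_eq by (simp add: currents_def cont_functionals_def linear_functional_on_def)

lemma coefficient_term_in_forms:
  assumes IJ: "index_set I" "index_set J" and AB: "A \<in> {I, J}" "B \<in> {I, J}" and f: "f \<in> test I J"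
  shows "coefficient_term q A B f \<in> lag_forms_c n q q U"
proof -
  have "(\<lambda>x. f x *\<^sub>R du A B) \<in> lag_forms_c n q q U"
    by (rule coefficient_form[OF f U_open]) (use IJ AB in \<open>auto simp: index_set_def\<close>)
  moreover have "coefficient_term q A B f = (-1) ^ (q * (q - 1) div 2) *\<^sub>R (\<lambda>x. f x *\<^sub>R du A B)"
    by (simp add: fun_eq_iff scaleR_fun_def)
  ultimately show ?thesis
    using subspace_scale[OF subspace_lag_forms_c[OF U_open]] by simp
qed

lemma cocoeff_linear:
  assumes "index_set I" "index_set J" "A \<in> {I, J}" "B \<in> {I, J}"
  shows "linear_functional_on (test I J) (cocoeff q T A B)"
  unfolding linear_functional_on_def cocoeff_def coefficient_term_linear
  using linear_functional_on_add[OF T_linear] linear_functional_on_scale[OF T_linear]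
    coefficient_term_in_forms[OF assms] by simp

text \<open>\<open>J\<close> exchanges \<open>d'u\<^sub>I \<and> d''u\<^sub>J\<close> and \<open>d'u\<^sub>J \<and> d''u\<^sub>I\<close> up to the sign \<open>(-1)\<^bsup>q\<^sup>2\<^esup> = (-1)\<^bsup>q\<^esup>\<close>, which is the sign
  in the symmetry of the current.\<close>

lemma cocoeff_symmetric:
  assumes "index_set I" "index_set J" "f \<in> test I J"
  shows "cocoeff q T I J f = cocoeff q T J I f"
proof -
  have \<omega>: "coefficient_term q I J f \<in> lag_forms_c n q q U" "coefficient_term q J I f \<in> lag_forms_c n q q U"
    by (rule coefficient_term_in_forms[OF assms(1,2) _ _ assms(3)]; simp)+
  have J: "Jval (c *\<^sub>R du I J) = c *\<^sub>R (-1) ^ q *\<^sub>R du J I" for c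
    using assms(1,2) by (auto simp: fun_eq_iff Jval_def scaleR_fun_def du_def index_set_def uminus_power_if)
  have "Jform (coefficient_term q I J f) = (-1) ^ q *\<^sub>R coefficient_term q J I f"
    unfolding Jform_def J by (simp add: fun_eq_iff scaleR_fun_def)
  then have "(-1) ^ q * T (coefficient_term q J I f) = T (Jform (coefficient_term q I J f))"
    by (simp only: linear_functional_on_scale[OF T_linear \<omega>(2)])
  also have "\<dots> = (-1) ^ q * T (coefficient_term q I J f)"
    using T_positive \<omega>(1) unfolding positive_current_def q_eq by blast
  finally show ?thesis by (simp add: cocoeff_def)
qed

text \<open>The value of \<open>T\<close> on \<open>(-1)\<^bsup>q(q-1)/2\<^esup> f \<alpha> \<and> J(\<alpha>)\<close> with \<open>\<alpha> = a d'u\<^sub>I + b d'u\<^sub>J\<close>. The two mixed terms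
  agree by symmetry. The case \<open>I = J\<close> is included, where \<open>\<alpha> = (a + b) d'u\<^sub>I\<close>.\<close>

lemma cocoeff_quadratic_form:
  assumes IJ: "index_set I" "index_set J"
  shows "positive_on (test I J)
    (\<lambda>f. a\<^sup>2 * cocoeff q T I I f + b\<^sup>2 * cocoeff q T J J f + 2 * a * b * cocoeff q T I J f)"
  unfolding positive_on_def
proof (intro ballI impI)
  fix f assume f: "f \<in> test I J" and f0: "\<forall>x. 0 \<le> f x"
  let ?s = "(-1) ^ (q * (q - 1) div 2) :: real"
  define \<alpha> :: lval where "\<alpha> = (\<lambda>A B. if B = {} then a * (if A = I then 1 else 0) + b * (if A = J then 1 else 0) else 0)"
  let ?t = "\<lambda>A B. coefficient_term q A B f"
  define \<omega> :: lform where "\<omega> = (a\<^sup>2 *\<^sub>R ?t I I + b\<^sup>2 *\<^sub>R ?t J J) + ((a * b) *\<^sub>R ?t I J + (a * b) *\<^sub>R ?t J I)"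
  have t: "?t A B \<in> lag_forms_c n q q U" if "A \<in> {I, J}" "B \<in> {I, J}" for A B
    by (rule coefficient_term_in_forms[OF IJ that f])
  note sub = subspace_lag_forms_c[OF U_open, of q q]
  have st: "c *\<^sub>R ?t A B \<in> lag_forms_c n q q U" if "A \<in> {I, J}" "B \<in> {I, J}" for A B c
    by (rule subspace_scale[OF sub t[OF that]])
  have \<omega>_form: "\<omega> \<in> lag_forms_c n q q U"
    unfolding \<omega>_def by (intro subspace_add[OF sub] st) auto
  have "T \<omega> = (a\<^sup>2 * T (?t I I) + b\<^sup>2 * T (?t J J)) + (a * b * T (?t I J) + a * b * T (?t J I))"
    unfolding \<omega>_def
    by (simp only: linear_functional_on_add[OF T_linear] linear_functional_on_scale[OF T_linear]
        st t subspace_add[OF sub] insertI1 insertI2 singletonI)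
  also have "\<dots> = a\<^sup>2 * cocoeff q T I I f + b\<^sup>2 * cocoeff q T J J f + 2 * a * b * cocoeff q T I J f"
    using cocoeff_symmetric[OF IJ f] by (simp add: cocoeff_def)
  finally have T\<omega>: "T \<omega> = \<dots>" .
  have \<alpha>_type: "lval_of_type S q 0 \<alpha>" if "I \<union> J \<subseteq> S" for S
    using that IJ by (auto simp: lval_of_type_def \<alpha>_def index_set_def split: if_splits)
  have fin: "finite (I \<union> J)"
    using IJ finite_subset[of _ "{1..n}"] by (auto simp: index_set_def)
  have \<omega>_eq: "\<omega> x = f x *\<^sub>R (?s *\<^sub>R wedge \<alpha> (Jval \<alpha>))" for x
    unfolding wedge_Jval[OF \<alpha>_type[OF order_refl] fin]
    by (simp add: \<omega>_def \<alpha>_def fun_eq_iff scaleR_fun_def du_def power2_eq_square algebra_simps)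
  have "pos_form n q U \<omega>"
    unfolding pos_form_def
  proof
    fix x assume x: "x \<in> U"
    show "\<omega> x \<in> pos_lvals ({1..n} - infs n x) q"
    proof (cases "f x = 0")
      case True
      then show ?thesis
        unfolding \<omega>_eq pos_lvals_def by (simp add: convex_cone_hull_contains_0)
    next
      case False
      then have "x \<in> Y I J" using test_functionsD(1)[OF f] by blast
      then have "x \<notin> Einf n (I \<union> J)" "x \<in> Rinf n"
        using openin_imp_subset[OF U_open] by auto
      then have "I \<union> J \<subseteq> {1..n} - infs n x"
        using IJ by (auto simp: index_set_def Einf_def infs_def)
      from \<alpha>_type[OF this] show ?thesis
        unfolding \<omega>_eq pos_lvals_def using f0 by (intro convex_cone_hull_mul hull_inc) auto
    qed
  qed
  then have "0 \<le> T \<omega>"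
    using T_positive \<omega>_form unfolding positive_current_def q_eq by blast
  then show "0 \<le> a\<^sup>2 * cocoeff q T I I f + b\<^sup>2 * cocoeff q T J J f + 2 * a * b * cocoeff q T I J f"
    using T\<omega> by simp
qed

definition diagonal_mean :: "nat set \<Rightarrow> nat set \<Rightarrow> (point \<Rightarrow> real) \<Rightarrow> real"
  where "diagonal_mean I J f = (1/2) * cocoeff q T I I f + (1/2) * cocoeff q T J J f"

lemma diagonal_mean_linear:
  assumes "index_set I" "index_set J"
  shows "linear_functional_on (test I J) (diagonal_mean I J)"
  unfolding diagonal_mean_def[abs_def]
  by (intro linear_functional_on_combination cocoeff_linear assms) auto

lemma cocoeff_dominated:
  assumes IJ: "index_set I" "index_set J"
  shows "dominated_on (test I J) (cocoeff q T I J) (diagonal_mean I J)"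
proof (rule dominated_onI)
  show "subspace (test I J)" by (rule subspace_test_functions[OF Y_open[OF IJ]])
  show "linear_functional_on (test I J) (cocoeff q T I J)"
    using cocoeff_linear[OF IJ] by simp
  show "linear_functional_on (test I J) (diagonal_mean I J)"
    by (rule diagonal_mean_linear[OF IJ])
  show "positive_on (test I J) (\<lambda>f. diagonal_mean I J f + cocoeff q T I J f)"
    using cocoeff_quadratic_form[OF IJ, of 1 1] by (auto simp: positive_on_def diagonal_mean_def)
  show "positive_on (test I J) (\<lambda>f. diagonal_mean I J f - cocoeff q T I J f)"
    using cocoeff_quadratic_form[OF IJ, of 1 "-1"] by (auto simp: positive_on_def diagonal_mean_def)
qed

section \<open>The co-coefficients as measures\<close>

definition cocoeff_measure :: "nat set \<Rightarrow> nat set \<Rightarrow> (point \<Rightarrow> real) \<Rightarrow> real"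
  where "cocoeff_measure I J = extension (test I J) (cocoeff q T I J)"

lemma cocoeff_measure_limit:
  assumes "index_set I" "index_set J" "order_approx (test I J) f g"
  shows "(\<lambda>k. cocoeff q T I J (g k)) \<longlonglongrightarrow> cocoeff_measure I J f"
  unfolding cocoeff_measure_def
  by (rule extension_limit[OF subspace_test_functions[OF Y_open] _ diagonal_mean_linear cocoeff_dominated assms(3)])
    (use assms cocoeff_linear[OF assms(1,2)] in auto)

lemma cocoeff_measure_radon:
  assumes IJ: "index_set I" "index_set J"
  shows "cocoeff_measure I J \<in> radon_measures (Y I J)"
  unfolding cocoeff_measure_def
  by (rule extension_radon_measure[OF Y_open[OF IJ] refl _ diagonal_mean_linear[OF IJ] cocoeff_dominated[OF IJ]])
    (use cocoeff_linear[OF IJ] in simp)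

lemma cocoeff_measure_extends:
  assumes IJ: "index_set I" "index_set J" and f: "f \<in> test I J"
  shows "cocoeff_measure I J f = cocoeff q T I J f"
  unfolding cocoeff_measure_def
  by (rule extension_eq[OF subspace_test_functions[OF Y_open[OF IJ]] _ diagonal_mean_linear[OF IJ]
        cocoeff_dominated[OF IJ] f])
    (use cocoeff_linear[OF IJ] in simp)

lemma approx_exists:
  assumes "index_set I" "index_set J" "f \<in> Cc (Y I J)"
  obtains g where "order_approx (test I J) f g"
  using Cc_order_approx[OF Y_open[OF assms(1,2)] assms(3)] by (elim exE) (rule that)

lemma cocoeff_measure_symmetric:
  assumes IJ: "index_set I" "index_set J" and f: "f \<in> Cc (Y I J)"
  shows "cocoeff_measure I J f = cocoeff_measure J I f"
proof -
  obtain g where g: "order_approx (test I J) f g"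
    by (rule approx_exists[OF IJ f])
  have "cocoeff q T I J (g k) = cocoeff q T J I (g k)" for k
    by (rule cocoeff_symmetric[OF IJ order_approx_mem[OF g]])
  then have "(\<lambda>k. cocoeff q T J I (g k)) \<longlonglongrightarrow> cocoeff_measure I J f"
    using cocoeff_measure_limit[OF IJ g] by simp
  moreover have "(\<lambda>k. cocoeff q T J I (g k)) \<longlonglongrightarrow> cocoeff_measure J I f"
    using cocoeff_measure_limit[OF IJ(2,1)] g by (simp add: Un_commute)
  ultimately show ?thesis by (rule LIMSEQ_unique)
qed

text \<open>The diagonal measures live on the larger sets \<open>U - E\<^bsup>I\<^esup>\<close> and \<open>U - E\<^bsup>J\<^esup>\<close>. To compare them with the
  mixed one, sequences of test functions on \<open>U - E\<^bsup>I\<union>J\<^esup>\<close> are used for all three.\<close>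

lemma test_mono:
  assumes IJ: "index_set I" "index_set J" and A: "A \<in> {I, J}"
  shows "test I J \<subseteq> test A A"
proof
  fix f assume f: "f \<in> test I J"
  have "Y A A - Einf n (I \<union> J) = Y I J"
    using A by (auto simp: Einf_def)
  then have f': "f \<in> test_functions n (Y A A - Einf n (I \<union> J))"
    using f by simp
  have "index_set A" using IJ A by auto
  then have "(\<lambda>x. f x *\<^sub>R du {} {}) \<in> lag_forms_c n 0 0 (Y A A)"
    by (intro coefficient_form[OF f' Y_open]) (use IJ in \<open>auto simp: index_set_def\<close>)
  then show "f \<in> test A A" by (simp add: test_functions_def)
qed

lemma diagonal_limit:
  assumes IJ: "index_set I" "index_set J" and A: "A \<in> {I, J}" and g: "order_approx (test I J) f g"
  shows "(\<lambda>k. cocoeff q T A A (g k)) \<longlonglongrightarrow> cocoeff_measure A A f"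
  by (rule cocoeff_measure_limit[OF _ _ order_approx_mono[OF g test_mono[OF IJ A]]]) (use IJ A in auto)

lemma cocoeff_measure_quadratic_form:
  assumes IJ: "index_set I" "index_set J" and f: "f \<in> Cc (Y I J)" "\<And>x. 0 \<le> f x"
  shows "0 \<le> a\<^sup>2 * cocoeff_measure I I f + b\<^sup>2 * cocoeff_measure J J f + 2 * a * b * cocoeff_measure I J f"
proof -
  obtain g where g: "order_approx (test I J) f g"
    by (rule approx_exists[OF IJ f(1)])
  let ?P = "\<lambda>f. 1 * (a\<^sup>2 * cocoeff q T I I f + b\<^sup>2 * cocoeff q T J J f) + 2 * a * b * cocoeff q T I J f"
  show ?thesis
  proof (rule extension_nonneg[OF subspace_test_functions[OF Y_open[OF IJ]] _ _ g f(2)])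
    show "linear_functional_on (test I J) ?P"
      by (intro linear_functional_on_combination cocoeff_linear IJ) auto
    show "positive_on (test I J) ?P"
      using cocoeff_quadratic_form[OF IJ, of a b] by simp
    show "(\<lambda>k. ?P (g k)) \<longlonglongrightarrow>
        a\<^sup>2 * cocoeff_measure I I f + b\<^sup>2 * cocoeff_measure J J f + 2 * a * b * cocoeff_measure I J f"
      unfolding mult_1_left
      by (intro tendsto_intros diagonal_limit[OF IJ _ g] cocoeff_measure_limit[OF IJ g]) auto
  qed
qed

lemma cocoeff_measure_linear:
  assumes IJ: "index_set I" "index_set J" and AB: "A = I \<and> B = J \<or> A = B \<and> A \<in> {I, J}"
  shows "linear_functional_on (Cc (Y I J)) (cocoeff_measure A B)"
proof -
  have AB': "index_set A" "index_set B" using IJ AB by auto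
  have sub: "test I J \<subseteq> test A B"
    using AB
  proof
    assume "A = B \<and> A \<in> {I, J}"
    then show ?thesis using test_mono[OF IJ, of A] by (elim conjE) (simp only:)
  qed (simp only: order_refl)
  have "\<exists>g. order_approx (test A B) f g" if f: "f \<in> Cc (Y I J)" for f
  proof -
    obtain g where g: "order_approx (test I J) f g"
      by (rule approx_exists[OF IJ f])
    show ?thesis
      by (rule exI[of _ g], rule order_approx_mono[OF g sub])
  qed
  then show ?thesis
    unfolding cocoeff_measure_def
    by (intro extension_linear[OF subspace_test_functions[OF Y_open[OF AB']] _ diagonal_mean_linear[OF AB']
        cocoeff_dominated[OF AB']] cocoeff_linear[OF AB']) auto
qed

text \<open>The quadratic inequality for \<open>f + h\<close> with \<open>(a, -b)\<close> and for \<open>f - h\<close> with \<open>(a, b)\<close>: in the sum, the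
  diagonal terms in \<open>h\<close> and the mixed terms in \<open>f\<close> cancel.\<close>

lemma cocoeff_measure_mixed_bound:
  assumes IJ: "index_set I" "index_set J" and f: "f \<in> Cc (Y I J)" and h: "h \<in> Cc (Y I J)"
    and le: "\<And>x. \<bar>h x\<bar> \<le> f x"
  shows "2 * a * b * cocoeff_measure I J h \<le> a\<^sup>2 * cocoeff_measure I I f + b\<^sup>2 * cocoeff_measure J J f"
proof -
  have nonneg: "0 \<le> (f + h) x" "0 \<le> (f - h) x" for x
    using le[of x] by (auto simp: abs_le_iff)
  have C: "f + h \<in> Cc (Y I J)" "f - h \<in> Cc (Y I J)"
    by (rule subspace_add[OF subspace_Cc f h], rule subspace_diff[OF subspace_Cc f h])
  have add: "cocoeff_measure A B (f + h) = cocoeff_measure A B f + cocoeff_measure A B h"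
      "cocoeff_measure A B (f - h) = cocoeff_measure A B f - cocoeff_measure A B h"
    if "A = I \<and> B = J \<or> A = B \<and> A \<in> {I, J}" for A B
    by (rule linear_functional_on_add[OF cocoeff_measure_linear[OF IJ that] f h],
        rule linear_functional_on_diff[OF subspace_Cc cocoeff_measure_linear[OF IJ that] f h])
  let ?II = "cocoeff_measure I I" and ?JJ = "cocoeff_measure J J" and ?IJ = "cocoeff_measure I J"
  have "0 \<le> a\<^sup>2 * (?II f + ?II h) + (- b)\<^sup>2 * (?JJ f + ?JJ h) + 2 * a * (- b) * (?IJ f + ?IJ h)"
    using cocoeff_measure_quadratic_form[OF IJ C(1) nonneg(1), of a "- b"]
    by (simp only: add insert_iff simp_thms)
  moreover have "0 \<le> a\<^sup>2 * (?II f - ?II h) + b\<^sup>2 * (?JJ f - ?JJ h) + 2 * a * b * (?IJ f - ?IJ h)"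
    using cocoeff_measure_quadratic_form[OF IJ C(2) nonneg(2), of a b]
    by (simp only: add insert_iff simp_thms)
  ultimately show ?thesis
    by (simp add: algebra_simps)
qed

lemma total_variation_estimate:
  assumes IJ: "index_set I" "index_set J" and ab: "0 \<le> a" "0 \<le> b"
  shows "measure_le (Y I J) ((a * b) *\<^sub>R total_variation (Y I J) (cocoeff_measure I J))
    ((1 / 2) *\<^sub>R (a\<^sup>2 *\<^sub>R cocoeff_measure I I + b\<^sup>2 *\<^sub>R cocoeff_measure J J))"
  unfolding measure_le_def
proof (intro ballI impI)
  fix f assume f: "f \<in> Cc (Y I J)" and f0: "\<forall>x. 0 \<le> f x"
  have "2 * a * b * total_variation (Y I J) (cocoeff_measure I J) f
      \<le> a\<^sup>2 * cocoeff_measure I I f + b\<^sup>2 * cocoeff_measure J J f"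
  proof (rule total_variation_le[OF cocoeff_measure_linear[OF IJ] f])
    show "2 * a * b * cocoeff_measure I J h \<le> a\<^sup>2 * cocoeff_measure I I f + b\<^sup>2 * cocoeff_measure J J f"
      if "h \<in> Cc (Y I J)" "\<And>x. \<bar>h x\<bar> \<le> f x" for h
      by (rule cocoeff_measure_mixed_bound[OF IJ f that])
  qed (use ab f0 in auto)
  then show "((a * b) *\<^sub>R total_variation (Y I J) (cocoeff_measure I J)) f
      \<le> ((1 / 2) *\<^sub>R (a\<^sup>2 *\<^sub>R cocoeff_measure I I + b\<^sup>2 *\<^sub>R cocoeff_measure J J)) f"
    by (simp add: scaleR_fun_def)
qed

end

theorem proposition5p2p6:
  fixes n p q :: nat and U :: "point set" and T :: "lform \<Rightarrow> real"
  assumes "p \<le> n" and "q = n - p"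
    and "openin (top_of_set (Rinf n)) U"
    and "T \<in> currents n p p U" and "positive_current n p U T"
  shows "\<exists>\<mu> :: nat set \<Rightarrow> nat set \<Rightarrow> (point \<Rightarrow> real) \<Rightarrow> real.
    \<forall>I J. I \<subseteq> {1..n} \<and> J \<subseteq> {1..n} \<and> card I = q \<and> card J = q \<longrightarrow>
      \<mu> I J \<in> radon_measures (U - Einf n (I \<union> J)) \<and>
      (\<forall>f \<in> test_functions n (U - Einf n (I \<union> J)). \<mu> I J f = cocoeff q T I J f) \<and>
      (\<forall>f \<in> Cc (U - Einf n (I \<union> J)). \<mu> I J f = \<mu> J I f) \<and>
      measure_le (U - Einf n I) 0 (\<mu> I I) \<and>
      (\<forall>a b. 0 \<le> a \<and> 0 \<le> b \<longrightarrow>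
         measure_le (U - Einf n (I \<union> J))
           ((a * b) *\<^sub>R total_variation (U - Einf n (I \<union> J)) (\<mu> I J))
           ((1 / 2) *\<^sub>R (a\<^sup>2 *\<^sub>R \<mu> I I + b\<^sup>2 *\<^sub>R \<mu> J J)))"
proof -
  interpret positive_lagerberg_current n p q U T
    by unfold_locales (fact assms)+
  show ?thesis
  proof (intro exI[of _ cocoeff_measure] allI impI, elim conjE)
    fix I J assume "I \<subseteq> {1..n}" "J \<subseteq> {1..n}" "card I = q" "card J = q"
    then have IJ: "index_set I" "index_set J" by (auto simp: index_set_def)
    have "measure_le (U - Einf n I) 0 (cocoeff_measure I I)"
      unfolding measure_le_def
    proof (intro ballI impI)
      fix f assume "f \<in> Cc (U - Einf n I)" "\<forall>x. 0 \<le> f x"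
      then show "0 f \<le> cocoeff_measure I I f"
        using cocoeff_measure_quadratic_form[OF IJ(1,1), of f 1 0] by simp
    qed
    then show "cocoeff_measure I J \<in> radon_measures (Y I J) \<and>
      (\<forall>f \<in> test I J. cocoeff_measure I J f = cocoeff q T I J f) \<and>
      (\<forall>f \<in> Cc (Y I J). cocoeff_measure I J f = cocoeff_measure J I f) \<and>
      measure_le (U - Einf n I) 0 (cocoeff_measure I I) \<and>
      (\<forall>a b. 0 \<le> a \<and> 0 \<le> b \<longrightarrow>
         measure_le (Y I J) ((a * b) *\<^sub>R total_variation (Y I J) (cocoeff_measure I J))
           ((1 / 2) *\<^sub>R (a\<^sup>2 *\<^sub>R cocoeff_measure I I + b\<^sup>2 *\<^sub>R cocoeff_measure J J)))"
      by (intro conjI ballI allI impI cocoeff_measure_radon cocoeff_measure_extends cocoeff_measure_symmetric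
          total_variation_estimate IJ) auto
  qed
qed

end
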